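(* Let $f$ be a measurable function on $\mathbb{R}^n$ and let $\delta\in (0,1)$. Suppose that there is a functional $a:\mathcal R\to(0,\infty)$ such that $$\inf_{c\in \mathbb R}\left (\frac1{|R|}\int_R |f(x)-c|^\delta\,dx\right )^{\frac{1}{\delta}} \le a(R) \qquad \text{for every } R\in \mathcal R.$$ If the functional $a$ satisfies the (unweighted) $D_{p,\mathcal R}$ condition for some $p>1$, or the (unweighted) $SD_{1,\mathcal R}^s$ condition for some $s>0$, then $$\inf_{c\in \mathbb R}\frac1{|R|}\int_R |f(x)-c|\, dx \leq C\, a(R) \qquad \text{for every } R\in \mathcal R,$$ where (the dimension $n$ being fixed) $C$ depends only on $p,\delta,\|a\|_{D_{p,\mathcal R}}$ in the first case and on $\delta,s,\|a\|_{SD^s_{1,\mathcal R}}$ in the second case.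
   Context: $\mathcal R$ is the family of rectangles in $\mathbb{R}^n$, i.e. $n$-fold products of bounded intervals of $\mathbb R$; $|E|$ is Lebesgue measure. Dyadic subrectangles of $R\in\mathcal R$: those obtained from $R$ by successively dividing rectangles into $2^n$ congruent subrectangles by bisecting every side (generation $0$ being $R$ itself). Condition $D_{p,\mathcal R}$: there is a constant $c$ such that for every $R\in\mathcal R$ and every family $\{R_i\}_i$ of pairwise disjoint dyadic subrectangles of $R$, $\big(\sum_i a(R_i)^p\frac{|R_i|}{|R|}\big)^{1/p}\le c\,a(R)$; the infimum of such $c$ is $\|a\|_{D_{p,\mathcal R}}$. Condition $SD^s_{1,\mathcal R}$: there is a constant $c$ such that for every $R\in\mathcal R$ and every family $\{R_i\}_i$ of pairwise disjoint dyadic subrectangles of $R$, $\sum_i a(R_i)\frac{|R_i|}{|R|}\le c\,\big(\frac{|\bigcup_iR_i|}{|R|}\big)^{1/s}a(R)$; the infimum of such $c$ is $\|a\|_{SD^s_{1,\mathcal R}}$. *)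

theory Defs
  imports "HOL-Analysis.Analysis"
begin

text \<open>Each side may be open, closed or half-open. Intervals with empty interior are excluded,
  because the volume of a rectangle occurs as a denominator.\<close>

definition rectangles :: "(real ^ 'n) set set" where
  "rectangles = {R. \<exists>I :: 'n \<Rightarrow> real set.
     (\<forall>i. is_interval (I i) \<and> bounded (I i) \<and> interior (I i) \<noteq> {}) \<and>
     R = {x. \<forall>i. x $ i \<in> I i}}"

definition midpt :: "(real ^ 'n) set \<Rightarrow> 'n \<Rightarrow> real" where
  "midpt R i = (Inf ((\<lambda>x. x $ i) ` R) + Sup ((\<lambda>x. x $ i) ` R)) / 2"

text \<open>When a side is bisected, its midpoint goes to the upper half, so that the \<open>2\<^sup>n\<close> pieces
  form a partition of the rectangle in the set-theoretic sense. Half-open rectangles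
  \<open>[a\<^sub>1, b\<^sub>1) \<times> \<dots> \<times> [a\<^sub>n, b\<^sub>n)\<close> are thus divided into rectangles of the same form. For other kinds
  of sides, the pieces are congruent up to boundary points. The set \<open>A\<close> below collects the
  coordinates in which the lower half is taken.\<close>

definition dyadic_children :: "(real ^ 'n) set \<Rightarrow> (real ^ 'n) set set" where
  "dyadic_children R =
     {{x \<in> R. \<forall>i. if i \<in> A then x $ i < midpt R i else midpt R i \<le> x $ i} | A. A \<subseteq> UNIV}"

inductive_set dyadic_subrectangles :: "(real ^ 'n) set \<Rightarrow> (real ^ 'n) set set"
  for R :: "(real ^ 'n) set" where
  base: "R \<in> dyadic_subrectangles R"
| step: "S \<in> dyadic_subrectangles R \<Longrightarrow> T \<in> dyadic_children S \<Longrightarrow> T \<in> dyadic_subrectangles R"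

text \<open>The power of an extended nonnegative real, meant for exponents \<open>r > 0\<close>.\<close>

definition ennreal_powr :: "ennreal \<Rightarrow> real \<Rightarrow> ennreal" where
  "ennreal_powr x r = (if x = \<infinity> then \<infinity> else ennreal (enn2real x powr r))"

text \<open>A family of pairwise disjoint dyadic subrectangles is given by the set of its members;
  nothing is lost, since dyadic subrectangles of a rectangle are nonempty. The families may be
  infinite, and the sums are taken in \<open>[0, \<infinity>]\<close>.\<close>

definition Dp_bound :: "real \<Rightarrow> ((real ^ 'n) set \<Rightarrow> real) \<Rightarrow> real \<Rightarrow> bool" where
  "Dp_bound p a c \<longleftrightarrow>
     (\<forall>R \<in> rectangles. \<forall>F \<subseteq> dyadic_subrectangles R. disjoint F \<longrightarrow>
        ennreal_powr
          (\<Sum>\<^sub>\<infinity>S\<in>F. ennreal (a S powr p * (measure lebesgue S / measure lebesgue R))) (1 / p)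
        \<le> ennreal (c * a R))"

definition Dp_condition :: "real \<Rightarrow> ((real ^ 'n) set \<Rightarrow> real) \<Rightarrow> bool" where
  "Dp_condition p a \<longleftrightarrow> (\<exists>c. Dp_bound p a c)"

definition Dp_norm :: "real \<Rightarrow> ((real ^ 'n) set \<Rightarrow> real) \<Rightarrow> real" where
  "Dp_norm p a = Inf {c. Dp_bound p a c}"

definition SD1_bound :: "real \<Rightarrow> ((real ^ 'n) set \<Rightarrow> real) \<Rightarrow> real \<Rightarrow> bool" where
  "SD1_bound s a c \<longleftrightarrow>
     (\<forall>R \<in> rectangles. \<forall>F \<subseteq> dyadic_subrectangles R. disjoint F \<longrightarrow>
        (\<Sum>\<^sub>\<infinity>S\<in>F. ennreal (a S * (measure lebesgue S / measure lebesgue R)))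
        \<le> ennreal (c * (measure lebesgue (\<Union>F) / measure lebesgue R) powr (1 / s) * a R))"

definition SD1_condition :: "real \<Rightarrow> ((real ^ 'n) set \<Rightarrow> real) \<Rightarrow> bool" where
  "SD1_condition s a \<longleftrightarrow> (\<exists>c. SD1_bound s a c)"

definition SD1_norm :: "real \<Rightarrow> ((real ^ 'n) set \<Rightarrow> real) \<Rightarrow> real" where
  "SD1_norm s a = Inf {c. SD1_bound s a c}"

end

theory Submission
  imports Defs
begin

text \<open>For each rectangle \<open>Q\<close> choose a constant \<open>c Q\<close> that is nearly optimal for the \<open>L\<^sup>\<delta>\<close> oscillation;
  by Chebyshev, \<open>\<bar>f - c Q\<bar> \<le> \<mu> a(Q)\<close> off a subset of \<open>Q\<close> of small proportion. The maximal dyadic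
  subrectangles \<open>S\<close> of \<open>R\<close> in which the exceptional set of \<open>R\<close> has density above \<open>2\<^sup>-\<^sup>n\<^sup>-\<^sup>1\<close> cover this
  set almost everywhere, their union has measure at most \<open>\<epsilon> |R|\<close>, and \<open>\<bar>c S - c R\<bar> \<le> \<mu> (a(R) + a(S))\<close>.
  Both conditions on \<open>a\<close> yield \<open>\<Sum> a(S) |S| \<le> a(R) |R| / 2\<close> once \<open>\<epsilon>\<close> is small. Inserting an estimate for
  the rectangles \<open>S\<close> into \<open>R\<close> therefore gives, by induction on \<open>k\<close>, the bound
  \<open>(5 \<mu> a(R) + \<epsilon>\<^sup>k M) |R|\<close> for the integral of \<open>min \<bar>f - c R\<bar> M\<close> over \<open>R\<close>, and one lets first \<open>k\<close> and
  then \<open>M\<close> tend to infinity.\<close>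

subsection \<open>Dyadic cells of a rectangle\<close>

text \<open>The faces are left undetermined on purpose: side lengths, midpoints and measure depend
  only on the open and the closed box, so all kinds of sides are treated at once.\<close>

definition corners :: "real ^ 'n \<Rightarrow> real ^ 'n \<Rightarrow> (real ^ 'n) set \<Rightarrow> bool" where
  "corners l u R \<longleftrightarrow> (\<forall>i. l $ i < u $ i) \<and> box l u \<subseteq> R \<and> R \<subseteq> cbox l u"

lemma corners_less: "corners l u R \<Longrightarrow> l $ i < u $ i"
  by (simp add: corners_def)

lemma corners_ge: "corners l u R \<Longrightarrow> x \<in> R \<Longrightarrow> l $ i \<le> x $ i"
  by (auto simp: corners_def mem_box_cart(2) dest!: subsetD)

lemma corners_le: "corners l u R \<Longrightarrow> x \<in> R \<Longrightarrow> x $ i \<le> u $ i"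
  by (auto simp: corners_def mem_box_cart(2) dest!: subsetD)

lemma corners_mem: "corners l u R \<Longrightarrow> (\<And>i. l $ i < x $ i \<and> x $ i < u $ i) \<Longrightarrow> x \<in> R"
  by (auto simp: corners_def mem_box_cart(1) dest!: subsetD)

lemma cornersI:
  assumes "\<And>i. l $ i < u $ i"
    and "\<And>x. (\<And>i. l $ i < x $ i \<and> x $ i < u $ i) \<Longrightarrow> x \<in> R"
    and "\<And>x i. x \<in> R \<Longrightarrow> l $ i \<le> x $ i \<and> x $ i \<le> u $ i"
  shows "corners l u R"
  unfolding corners_def
proof (intro conjI allI subsetI)
  show "x \<in> R" if "x \<in> box l u" for x
    using that assms(2) by (simp add: mem_box_cart(1))
  show "x \<in> cbox l u" if "x \<in> R" for x
    using that assms(3) by (simp add: mem_box_cart(2))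
qed (rule assms(1))

section \<open>Corners of a rectangle and midpoints of its sides\<close>

lemma bounded_interval_endpoints:
  fixes I :: "real set"
  assumes "is_interval I" "bounded I" "interior I \<noteq> {}"
  shows "Inf I < Sup I" "{Inf I<..<Sup I} \<subseteq> I" "I \<subseteq> {Inf I..Sup I}"
proof -
  have bdd: "bdd_above I" "bdd_below I"
    using \<open>bounded I\<close> bounded_imp_bdd_above bounded_imp_bdd_below by auto
  have ne: "I \<noteq> {}"
    using assms(3) interior_subset by blast
  show sub: "I \<subseteq> {Inf I..Sup I}"
    using bdd by (auto intro: cInf_lower cSup_upper)
  have "interior I \<subseteq> interior {Inf I..Sup I}"
    using sub by (rule interior_mono)
  then show "Inf I < Sup I"
    using assms(3) by force
  show "{Inf I<..<Sup I} \<subseteq> I"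
  proof
    fix x assume "x \<in> {Inf I<..<Sup I}"
    then obtain y z where "y \<in> I" "y < x" "z \<in> I" "x < z"
      using ne bdd by (auto simp: cInf_less_iff less_cSup_iff)
    then show "x \<in> I"
      using mem_is_interval_1_I[OF \<open>is_interval I\<close>] less_imp_le by metis
  qed
qed

lemma rectangle_corners:
  assumes "R \<in> rectangles"
  obtains l u where "corners l u R"
proof -
  obtain I where I: "\<And>i. is_interval (I i) \<and> bounded (I i) \<and> interior (I i) \<noteq> {}"
    and R: "R = {x. \<forall>i. x $ i \<in> I i}"
    using assms by (auto simp: rectangles_def)
  have "corners (\<chi> i. Inf (I i)) (\<chi> i. Sup (I i)) R"
    unfolding corners_def R
  proof (intro conjI allI subsetI)
    fix i show "(\<chi> i. Inf (I i)) $ i < (\<chi> i. Sup (I i)) $ i"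
      using bounded_interval_endpoints(1) I by simp
  next
    fix x assume x: "x \<in> box (\<chi> i. Inf (I i)) (\<chi> i. Sup (I i))"
    have "x $ i \<in> I i" for i
      using bounded_interval_endpoints(2)[of "I i"] I[of i] x by (auto simp: mem_box_cart subset_iff)
    then show "x \<in> {x. \<forall>i. x $ i \<in> I i}" by blast
  next
    fix x assume "x \<in> {x. \<forall>i. x $ i \<in> I i}"
    then have "x $ i \<in> {Inf (I i)..Sup (I i)}" for i
      using bounded_interval_endpoints(3)[of "I i"] I[of i] by blast
    then show "x \<in> cbox (\<chi> i. Inf (I i)) (\<chi> i. Sup (I i))" by (simp add: mem_box_cart)
  qed
  then show ?thesis by (rule that)
qed

text \<open>Each projection of \<open>R\<close> lies between the open and the closed interval with
  the same endpoints, so its infimum and supremum do not depend on which faces belong to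
  \<open>R\<close>.\<close>

lemma corners_midpt:
  assumes c: "corners l u R"
  shows "midpt R i = (l $ i + u $ i) / 2"
proof -
  let ?P = "(\<lambda>x. x $ i) ` R"
  have lu: "l $ i < u $ i" using c by (rule corners_less)
  have sup: "?P \<subseteq> {l $ i..u $ i}"
    using corners_ge[OF c] corners_le[OF c] by (simp add: image_subset_iff)
  have sub: "{l $ i<..<u $ i} \<subseteq> ?P"
  proof
    fix t assume t: "t \<in> {l $ i<..<u $ i}"
    \<comment> \<open>The other coordinates are centered, which keeps the point in the open
      box.\<close>
    define x where "x = (\<chi> j. if j = i then t else (l $ j + u $ j) / 2)"
    have "l $ j < x $ j \<and> x $ j < u $ j" for j
      using t corners_less[OF c, of j] by (simp add: x_def)
    then have "x \<in> R"
      by (rule corners_mem[OF c])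
    moreover have "t = x $ i" by (simp add: x_def)
    ultimately show "t \<in> ?P" by (rule rev_image_eqI)
  qed
  have ne: "{l $ i<..<u $ i} \<noteq> {}" using lu by simp
  then have ne': "?P \<noteq> {}" using sub by auto
  have bdd: "bdd_above ?P" "bdd_below ?P"
    using bdd_above_mono[OF bdd_above_Icc sup] bdd_below_mono[OF bdd_below_Icc sup] .
  have "Inf ?P = l $ i"
    using cInf_superset_mono[OF ne' bdd_below_Icc sup] cInf_superset_mono[OF ne bdd(2) sub] lu by simp
  moreover have "Sup ?P = u $ i"
    using cSup_subset_mono[OF ne' bdd_above_Icc sup] cSup_subset_mono[OF ne bdd(1) sub] lu by simp
  ultimately show ?thesis by (simp add: midpt_def)
qed

text \<open>Children are indexed by points instead of sets of coordinates: only the position of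
  \<open>x\<close> relative to the midpoints counts, and \<open>x\<close> may lie outside
  \<open>R\<close>. This makes it possible to follow the piece around a given point through all
  generations.\<close>

definition child :: "(real ^ 'n) set \<Rightarrow> real ^ 'n \<Rightarrow> (real ^ 'n) set" where
  "child R x = {y \<in> R. \<forall>i. y $ i < midpt R i \<longleftrightarrow> x $ i < midpt R i}"

lemma child_in_dyadic_children: "child R x \<in> dyadic_children R"
proof -
  have "child R x = {y \<in> R. \<forall>i. if i \<in> {i. x $ i < midpt R i} then y $ i < midpt R i else midpt R i \<le> y $ i}"
    by (auto simp: child_def simp flip: not_less)
  then show ?thesis unfolding dyadic_children_def by blast
qed

lemma child_corners:
  assumes c: "corners l u R"
  shows "corners (\<chi> i. if x $ i < midpt R i then l $ i else midpt R i)
           (\<chi> i. if x $ i < midpt R i then midpt R i else u $ i) (child R x)" (is "corners ?l ?u _")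
proof (rule cornersI)
  have m: "l $ i < midpt R i" "midpt R i < u $ i" for i
    using corners_less[OF c, of i] by (simp_all add: corners_midpt[OF c])
  show "?l $ i < ?u $ i" for i
    using m[of i] by simp
  show "y \<in> child R x" if y: "\<And>i. ?l $ i < y $ i \<and> y $ i < ?u $ i" for y
  proof -
    have *: "l $ i < y $ i \<and> y $ i < u $ i \<and> (y $ i < midpt R i \<longleftrightarrow> x $ i < midpt R i)" for i
      using y[of i] m[of i] by (simp split: if_splits)
    then have "y \<in> R" by (intro corners_mem[OF c]) blast
    then show ?thesis using * by (simp add: child_def)
  qed
  show "?l $ i \<le> y $ i \<and> y $ i \<le> ?u $ i" if "y \<in> child R x" for y i
  proof -
    have "y \<in> R" "y $ i < midpt R i \<longleftrightarrow> x $ i < midpt R i"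
      using that by (simp_all add: child_def)
    then show ?thesis
      using corners_ge[OF c, of y i] corners_le[OF c, of y i]
      by (cases "x $ i < midpt R i") simp_all
  qed
qed

lemma child_rectangle:
  assumes "R \<in> rectangles"
  shows "child R x \<in> rectangles"
proof -
  obtain I where I: "\<And>i. is_interval (I i) \<and> bounded (I i) \<and> interior (I i) \<noteq> {}"
    and R: "R = {x. \<forall>i. x $ i \<in> I i}"
    using assms by (auto simp: rectangles_def)
  obtain l u where c: "corners l u R"
    using rectangle_corners[OF assms] .
  define J where "J i = I i \<inter> {t. t < midpt R i \<longleftrightarrow> x $ i < midpt R i}" for i
  have child_eq: "child R x = {y. \<forall>i. y $ i \<in> J i}"
    by (auto simp: child_def J_def R)
  obtain l' u' where c': "corners l' u' (child R x)"
    using child_corners[OF c] by blast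
  have "is_interval (J i) \<and> bounded (J i) \<and> interior (J i) \<noteq> {}" for i
  proof (intro conjI)
    show "is_interval (J i)"
      using I[of i] unfolding J_def is_interval_1 by auto
    show "bounded (J i)"
      using I[of i] by (auto simp: J_def intro: bounded_subset)
    \<comment> \<open>The corners of the child show that the cut leaves interior in every factor:
      each \<open>t\<close> strictly between them is a coordinate of a point of the child.\<close>
    have "{l' $ i<..<u' $ i} \<subseteq> J i"
    proof
      fix t assume t: "t \<in> {l' $ i<..<u' $ i}"
      define y where "y = (\<chi> j. if j = i then t else (l' $ j + u' $ j) / 2)"
      have "l' $ j < y $ j \<and> y $ j < u' $ j" for j
        using t corners_less[OF c', of j] by (simp add: y_def)
      then have "y \<in> child R x" by (rule corners_mem[OF c'])
      then have "y $ i \<in> J i" by (simp add: child_eq)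
      then show "t \<in> J i" by (simp add: y_def)
    qed
    then have "{l' $ i<..<u' $ i} \<subseteq> interior (J i)"
      by (rule interior_maximal) simp
    moreover have "{l' $ i<..<u' $ i} \<noteq> {}"
      using corners_less[OF c', of i] by simp
    ultimately show "interior (J i) \<noteq> {}" by auto
  qed
  then show ?thesis unfolding rectangles_def using child_eq by blast
qed

text \<open>What \<open>R\<close> lacks of the closed box lies on the frontier of the box, which is
  negligible.\<close>

lemma corners_measure:
  fixes R :: "(real ^ 'n) set"
  assumes "corners l u R"
  shows "R \<in> lmeasurable" "measure lebesgue R = (\<Prod>i\<in>UNIV. u $ i - l $ i)"
proof -
  have lu: "\<And>i. l $ i < u $ i" and sub: "box l u \<subseteq> R" "R \<subseteq> cbox l u"
    using assms by (simp_all add: corners_def)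
  have N: "negligible (cbox l u - R)"
    using negligible_frontier_interval[of l u] sub(1) by (rule negligible_subset[OF _ Diff_mono[OF order.refl]])
  have eq: "R = cbox l u - (cbox l u - R)" using sub by blast
  have s: "sym_diff (cbox l u) R = cbox l u - R" using sub by blast
  show "R \<in> lmeasurable"
    using lmeasurable_negligible_symdiff[of "cbox l u" R] N s by simp
  have "measure lebesgue R = measure lebesgue (cbox l u)"
    using measure_negligible_symdiff[of "cbox l u" R] N s by simp
  also have "\<dots> = (\<Prod>i\<in>UNIV. u $ i - l $ i)"
    using lu by (subst measure_completion) (auto simp: content_cbox_cart interval_ne_empty_cart less_imp_le)
  finally show "measure lebesgue R = (\<Prod>i\<in>UNIV. u $ i - l $ i)" .
qed

section \<open>Measure of rectangles and of their children\<close>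

lemma rectangle_lmeasurable: "R \<in> rectangles \<Longrightarrow> R \<in> lmeasurable"
  by (erule rectangle_corners) (rule corners_measure(1))

lemma rectangle_measure_pos: "R \<in> rectangles \<Longrightarrow> 0 < measure lebesgue R"
  by (erule rectangle_corners) (simp add: corners_measure(2) corners_less prod_pos)

text \<open>Bisection halves every side, whichever faces the child inherits. The factor is what a
  density bound loses in passing from a cell to its child.\<close>

lemma child_measure:
  fixes R :: "(real ^ 'n) set"
  assumes "R \<in> rectangles"
  shows "measure lebesgue R = 2 ^ CARD('n) * measure lebesgue (child R x)"
proof -
  obtain l u where c: "corners l u R"
    using rectangle_corners[OF assms] .
  have "measure lebesgue (child R x) = (\<Prod>i\<in>UNIV. (u $ i - l $ i) / 2)"
    unfolding corners_measure(2)[OF child_corners[OF c]]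
    by (rule prod.cong) (auto simp: corners_midpt[OF c] field_simps)
  also have "\<dots> = measure lebesgue R / 2 ^ CARD('n)"
    by (simp add: corners_measure(2)[OF c] prod_dividef)
  finally show ?thesis by simp
qed

text \<open>Disjoint sets with nonempty interior form a countable family; this is how disjoint
  families of rectangles are seen to be countable.\<close>

lemma rectangle_interior:
  assumes "R \<in> rectangles"
  shows "interior R \<noteq> {}"
proof -
  obtain l u where c: "corners l u R"
    using rectangle_corners[OF assms] .
  then have "box l u \<subseteq> interior R"
    by (intro interior_maximal) (auto simp: corners_def)
  moreover have "box l u \<noteq> {}"
    using corners_less[OF c] by (simp add: interval_ne_empty_cart)
  ultimately show ?thesis by blast
qed

text \<open>For \<open>x\<close> in \<open>R\<close> this is the piece of generation
  \<open>k\<close> that contains \<open>x\<close>. For other \<open>x\<close> it is still some piece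
  of that generation, so \<open>cell_rectangle\<close> and \<open>cell_dyadic\<close> hold for every
  \<open>x\<close>.\<close>

primrec cell :: "(real ^ 'n) set \<Rightarrow> nat \<Rightarrow> real ^ 'n \<Rightarrow> (real ^ 'n) set" where
  "cell R 0 x = R"
| "cell R (Suc k) x = child (cell R k x) x"

lemma cell_rectangle: "R \<in> rectangles \<Longrightarrow> cell R k x \<in> rectangles"
  by (induction k) (auto intro: child_rectangle)

lemma cell_dyadic: "cell R k x \<in> dyadic_subrectangles R"
  by (induction k) (auto intro: dyadic_subrectangles.intros child_in_dyadic_children)

lemma mem_cell: "x \<in> R \<Longrightarrow> x \<in> cell R k x"
  by (induction k) (auto simp: child_def)

lemma cell_subset: "cell R k x \<subseteq> R"
  by (induction k) (auto simp: child_def)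

text \<open>The tree structure of the dyadic pieces: all points of a cell share its ancestors, so
  two cells with a common point are nested.\<close>

lemma cell_eq: "y \<in> cell R k x \<Longrightarrow> j \<le> k \<Longrightarrow> cell R j y = cell R j x"
proof (induction k arbitrary: j)
  case (Suc k)
  show ?case
  proof (cases "j = Suc k")
    case True
    have "y \<in> cell R k x" using Suc.prems by (simp add: child_def)
    then have "cell R k y = cell R k x" using Suc.IH by blast
    then show ?thesis using True Suc.prems by (auto simp: child_def)
  next
    case False
    then show ?thesis using Suc by (auto simp: child_def)
  qed
qed simp

text \<open>The sides of the generation \<open>k\<close> cell are those of \<open>R\<close> divided
  by \<open>2 ^ k\<close>, so the cells around \<open>x\<close> shrink to \<open>x\<close>.\<close>

lemma cell_in_open:
  fixes R :: "(real ^ 'n) set"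
  assumes "R \<in> rectangles" "open U" "x \<in> U" "x \<in> R"
  obtains k where "cell R k x \<subseteq> U"
proof -
  obtain l u where c: "corners l u R"
    using rectangle_corners[OF assms(1)] .
  have side: "\<exists>l' u'. corners l' u' (cell R k x) \<and> (\<forall>i. u' $ i - l' $ i = (u $ i - l $ i) / 2 ^ k)" for k
  proof (induction k)
    case 0
    then show ?case using c by auto
  next
    case (Suc k)
    then obtain l' u' where c': "corners l' u' (cell R k x)"
      and d: "\<And>i. u' $ i - l' $ i = (u $ i - l $ i) / 2 ^ k" by blast
    have "(if x $ i < midpt (cell R k x) i then midpt (cell R k x) i else u' $ i) -
       (if x $ i < midpt (cell R k x) i then l' $ i else midpt (cell R k x) i) = (u $ i - l $ i) / 2 ^ Suc k" for i
    proof -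
      have "(u $ i - l $ i) / 2 ^ Suc k = (u' $ i - l' $ i) / 2" by (simp add: d)
      then show ?thesis by (auto simp: corners_midpt[OF c'] field_simps)
    qed
    then show ?case using child_corners[OF c', of x] by force
  qed
  obtain e where e: "e > 0" "ball x e \<subseteq> U"
    using assms(2,3) by (auto simp: open_contains_ball)
  \<comment> \<open>The sum of the coordinate distances dominates the norm, so
    \<open>D / 2 ^ k\<close> bounds the distance from \<open>x\<close> within its cell.\<close>
  define D where "D = (\<Sum>i\<in>UNIV. u $ i - l $ i)"
  obtain k where k: "D / e < 2 ^ k" using real_arch_pow[of 2] by auto
  obtain l' u' where c': "corners l' u' (cell R k x)"
    and d: "\<And>i. u' $ i - l' $ i = (u $ i - l $ i) / 2 ^ k" using side by blast
  have "y \<in> U" if "y \<in> cell R k x" for y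
  proof -
    have "\<bar>(x - y) $ i\<bar> \<le> (u $ i - l $ i) / 2 ^ k" for i
    proof -
      have "l' $ i \<le> y $ i" "y $ i \<le> u' $ i" "l' $ i \<le> x $ i" "x $ i \<le> u' $ i"
        using corners_ge[OF c'] corners_le[OF c'] that mem_cell[OF assms(4)] by blast+
      then show ?thesis using d[of i] by simp
    qed
    then have "norm (x - y) \<le> (\<Sum>i\<in>UNIV. (u $ i - l $ i) / 2 ^ k)"
      by (intro order.trans[OF norm_le_l1_cart] sum_mono)
    also have "\<dots> = D / 2 ^ k" by (simp add: D_def sum_divide_distrib)
    also have "\<dots> < e" using k e(1) by (simp add: field_simps)
    finally show ?thesis using e(2) by (auto simp: dist_norm)
  qed
  then show ?thesis using that by blast
qed

subsection \<open>Maximal cells\<close>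

text \<open>These are the maximal cells with property \<open>P\<close>: for each point whose chain
  of cells meets \<open>P\<close>, the first such cell is taken.\<close>

definition stopping :: "(real ^ 'n) set \<Rightarrow> ((real ^ 'n) set \<Rightarrow> bool) \<Rightarrow> (real ^ 'n) set set" where
  "stopping R P = (\<lambda>x. cell R (LEAST k. P (cell R k x)) x) ` {x \<in> R. \<exists>k. P (cell R k x)}"

lemma stopping_dyadic: "stopping R P \<subseteq> dyadic_subrectangles R"
  by (auto simp: stopping_def cell_dyadic)

lemma stopping_rectangles: "R \<in> rectangles \<Longrightarrow> stopping R P \<subseteq> rectangles"
  by (auto simp: stopping_def cell_rectangle)

lemma Union_stopping: "\<Union>(stopping R P) = {x \<in> R. \<exists>k. P (cell R k x)}"
proof
  show "\<Union>(stopping R P) \<subseteq> {x \<in> R. \<exists>k. P (cell R k x)}"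
  proof
    fix z assume "z \<in> \<Union>(stopping R P)"
    then obtain x k where k: "P (cell R k x)"
      and z: "z \<in> cell R (LEAST k. P (cell R k x)) x"
      by (auto simp: stopping_def)
    let ?k = "LEAST k. P (cell R k x)"
    have "cell R ?k z = cell R ?k x" using z by (rule cell_eq) simp
    moreover have "P (cell R ?k x)" using k by (rule LeastI)
    ultimately show "z \<in> {x \<in> R. \<exists>k. P (cell R k x)}"
      using z cell_subset[of R ?k x] by (metis (mono_tags, lifting) mem_Collect_eq subsetD)
  qed
  show "{x \<in> R. \<exists>k. P (cell R k x)} \<subseteq> \<Union>(stopping R P)"
    by (auto simp: stopping_def intro: mem_cell)
qed

text \<open>The chains of two points of a cell agree down to its generation, so every point of a
  selected cell selects that same cell. Hence two selected cells with a common point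
  coincide.\<close>

lemma stopping_disjoint: "disjoint (stopping R P)"
proof -
  have same: "cell R (LEAST k. P (cell R k z)) z = cell R (LEAST k. P (cell R k x)) x"
    if k: "P (cell R k x)" and z: "z \<in> cell R (LEAST k. P (cell R k x)) x" for x z k
  proof -
    let ?k = "LEAST k. P (cell R k x)"
    have eq: "cell R j z = cell R j x" if "j \<le> ?k" for j
      using z that by (rule cell_eq)
    have P: "P (cell R ?k x)" using k by (rule LeastI)
    have "(LEAST k. P (cell R k z)) = ?k"
    proof (rule Least_equality)
      show "P (cell R ?k z)" using P eq by simp
      show "?k \<le> j" if "P (cell R j z)" for j
      proof (rule ccontr)
        assume "\<not> ?k \<le> j"
        then have "j < ?k" by simp
        moreover from this have "P (cell R j x)" using that eq by simp
        ultimately show False using not_less_Least by blast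
      qed
    qed
    then show ?thesis using eq by simp
  qed
  show ?thesis
  proof (rule pairwiseI)
    fix S T assume "S \<in> stopping R P" "T \<in> stopping R P" "S \<noteq> T"
    then obtain x k y j where "P (cell R k x)" "S = cell R (LEAST k. P (cell R k x)) x"
      "P (cell R j y)" "T = cell R (LEAST k. P (cell R k y)) y"
      by (auto simp: stopping_def)
    with \<open>S \<noteq> T\<close> same show "disjnt S T" unfolding disjnt_iff by metis
  qed
qed

text \<open>By minimality of the generation, the parent fails \<open>P\<close> unless the selection
  happens at \<open>R\<close> itself. For a density condition this gives an upper bound on the
  density in \<open>S\<close>.\<close>

lemma stoppingE:
  assumes "S \<in> stopping R P"
  obtains "P S" "S = R"
    | j x where "P S" "S = child (cell R j x) x" "\<not> P (cell R j x)"
proof -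
  obtain x k where k: "P (cell R k x)" and S: "S = cell R (LEAST k. P (cell R k x)) x"
    using assms by (auto simp: stopping_def)
  have P: "P S" unfolding S using k by (rule LeastI)
  show ?thesis
  proof (cases "LEAST k. P (cell R k x)")
    case 0
    then show ?thesis using that(1) P S by simp
  next
    case (Suc j)
    then have "\<not> P (cell R j x)" using not_less_Least[of j "\<lambda>k. P (cell R k x)"] by simp
    then show ?thesis using that(2) P S Suc by simp
  qed
qed

section \<open>Disjoint families of rectangles and integrals over their unions\<close>

lemma countable_disjoint_rectangles: "F \<subseteq> rectangles \<Longrightarrow> disjoint F \<Longrightarrow> countable F"
  by (rule countable_disjoint_nonempty_interior_subsets) (auto dest: rectangle_interior)

lemma rectangle_sets: "R \<in> rectangles \<Longrightarrow> R \<in> sets lebesgue"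
  by (intro fmeasurableD rectangle_lmeasurable)

lemma emeasure_rectangle: "R \<in> rectangles \<Longrightarrow> emeasure lebesgue R = ennreal (measure lebesgue R)"
  by (intro emeasure_eq_measure2 rectangle_lmeasurable)

lemma sets_Union_rectangles:
  "F \<subseteq> rectangles \<Longrightarrow> disjoint F \<Longrightarrow> \<Union>F \<in> sets lebesgue"
  by (intro sets.countable_Union countable_disjoint_rectangles) (auto intro: rectangle_sets)

text \<open>This is countable additivity of the measure with density \<open>g\<close>; sums over
  \<open>F\<close> are written as integrals for the counting measure.\<close>

lemma nn_integral_Union_rectangles:
  fixes g :: "real ^ 'n \<Rightarrow> ennreal"
  assumes F: "F \<subseteq> rectangles" "disjoint F" and g: "g \<in> borel_measurable lebesgue"
  shows "(\<integral>\<^sup>+x\<in>\<Union>F. g x \<partial>lebesgue) = (\<integral>\<^sup>+S. (\<integral>\<^sup>+x\<in>S. g x \<partial>lebesgue) \<partial>count_space F)"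
proof -
  have "emeasure (density lebesgue g) (\<Union>F) = (\<integral>\<^sup>+S. emeasure (density lebesgue g) S \<partial>count_space F)"
    using emeasure_UN_countable[of F "\<lambda>S. S" "density lebesgue g"] F
    by (auto simp: countable_disjoint_rectangles disjoint_family_on_def disjnt_def pairwise_def
        intro: rectangle_sets)
  also have "\<dots> = (\<integral>\<^sup>+S. (\<integral>\<^sup>+x\<in>S. g x \<partial>lebesgue) \<partial>count_space F)"
    using F g by (intro nn_integral_cong) (auto intro!: emeasure_density rectangle_sets)
  finally show ?thesis
    using g by (simp add: emeasure_density sets_Union_rectangles[OF F])
qed

lemma emeasure_Int_Union_rectangles:
  assumes F: "F \<subseteq> rectangles" "disjoint F" and A: "A \<in> sets lebesgue"
  shows "emeasure lebesgue (A \<inter> \<Union>F) = (\<integral>\<^sup>+S. emeasure lebesgue (A \<inter> S) \<partial>count_space F)"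
proof -
  have "emeasure lebesgue (A \<inter> \<Union>F) = (\<integral>\<^sup>+x\<in>\<Union>F. indicator A x \<partial>lebesgue)"
    using A sets_Union_rectangles[OF F]
    by (simp add: indicator_inter_arith[symmetric])
  also have "\<dots> = (\<integral>\<^sup>+S. (\<integral>\<^sup>+x\<in>S. indicator A x \<partial>lebesgue) \<partial>count_space F)"
    using A by (intro nn_integral_Union_rectangles F) auto
  also have "\<dots> = (\<integral>\<^sup>+S. emeasure lebesgue (A \<inter> S) \<partial>count_space F)"
  proof (rule nn_integral_cong)
    fix S assume "S \<in> space (count_space F)"
    then have "A \<inter> S \<in> sets lebesgue" using F A by (auto intro: rectangle_sets)
    then show "(\<integral>\<^sup>+x\<in>S. indicator A x \<partial>lebesgue) = emeasure lebesgue (A \<inter> S)"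
      by (simp add: indicator_inter_arith[symmetric])
  qed
  finally show ?thesis .
qed

lemma emeasure_Union_rectangles:
  assumes F: "F \<subseteq> rectangles" "disjoint F"
  shows "emeasure lebesgue (\<Union>F) = (\<integral>\<^sup>+S. emeasure lebesgue S \<partial>count_space F)"
  using emeasure_Int_Union_rectangles[OF F, of UNIV] by simp

text \<open>A substitute for the Lebesgue density theorem along the dyadic filtration: cover the
  exceptional set by the maximal cells inside an open set of almost the same measure.\<close>

lemma null_outside_dense_cells:
  fixes R :: "(real ^ 'n) set"
  assumes R: "R \<in> rectangles" and E: "E \<in> sets lebesgue" "E \<subseteq> R" and q: "0 < q" "q < 1"
  shows "E - \<Union>(stopping R (\<lambda>S. q * measure lebesgue S < measure lebesgue (S \<inter> E))) \<in> null_sets lebesgue"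
    (is "E - \<Union>?F \<in> _")
proof -
  define A where "A = E - \<Union>?F"
  note F = stopping_rectangles[OF R] stopping_disjoint
  have "A \<in> sets lebesgue"
    unfolding A_def using E(1) sets_Union_rectangles[OF F] by blast
  moreover have "A \<subseteq> R" using E by (auto simp: A_def)
  ultimately have A: "A \<in> lmeasurable"
    using rectangle_lmeasurable[OF R] by (blast intro: fmeasurableI2)
  have EI: "T \<inter> E \<in> lmeasurable" if "T \<in> rectangles" for T
    using rectangle_lmeasurable[OF that] E(1) by (rule fmeasurable_Int_fmeasurable)
  \<comment> \<open>Since \<open>q < 1\<close>, such a bound for every \<open>e > 0\<close> excludes
    positive measure.\<close>
  have "measure lebesgue A \<le> q * measure lebesgue A + e" if "e > 0" for e
  proof -
    obtain U where U: "open U" "A \<subseteq> U" "U - A \<in> lmeasurable" "emeasure lebesgue (U - A) < ennreal e"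
      using sets_lebesgue_outer_open[OF fmeasurableD[OF A] \<open>e > 0\<close>] .
    \<comment> \<open>Each point of \<open>A\<close> has a cell inside the open set
      \<open>U\<close>. The maximal ones cover \<open>A\<close> and exceed it by measure less than
      \<open>e\<close>.\<close>
    let ?G = "stopping R (\<lambda>S. S \<subseteq> U)"
    have GU: "\<Union>?G \<subseteq> U"
      by (auto simp: Union_stopping dest: mem_cell)
    have AG: "A \<subseteq> \<Union>?G"
      unfolding Union_stopping using cell_in_open[OF R U(1)] U(2) \<open>A \<subseteq> R\<close> by blast
    have "emeasure lebesgue (A \<inter> S) \<le> ennreal q * emeasure lebesgue S" if SG: "S \<in> ?G" for S
    proof -
      obtain x k where S: "S = cell R k x" "x \<in> R"
        using SG unfolding stopping_def by blast
      have Sr: "S \<in> rectangles" using S R by (simp add: cell_rectangle)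
      show ?thesis
      proof (cases "q * measure lebesgue S < measure lebesgue (S \<inter> E)")
        \<comment> \<open>A dense cell occurs in the chain of each of its points, so it lies in the
          union that was removed from \<open>E\<close> and misses \<open>A\<close>.\<close>
        case True
        have "z \<in> \<Union>?F" if "z \<in> S" for z
        proof -
          have "cell R k z = S" using that cell_eq[of z R k x k] S by simp
          moreover have "z \<in> R" using that S cell_subset by blast
          ultimately show ?thesis using True unfolding Union_stopping by blast
        qed
        then have "A \<inter> S = {}" by (auto simp: A_def)
        then show ?thesis by simp
      next
        case False
        have "emeasure lebesgue (A \<inter> S) \<le> emeasure lebesgue (S \<inter> E)"
          using EI[OF Sr] by (intro emeasure_mono) (auto simp: A_def)
        also have "\<dots> = ennreal (measure lebesgue (S \<inter> E))"
          using EI[OF Sr] by (rule emeasure_eq_measure2)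
        also have "\<dots> \<le> ennreal (q * measure lebesgue S)"
          using False by (intro ennreal_leI) simp
        also have "\<dots> = ennreal q * emeasure lebesgue S"
          using q by (simp add: emeasure_rectangle[OF Sr] ennreal_mult)
        finally show ?thesis .
      qed
    qed
    note small = this
    have "emeasure lebesgue A = emeasure lebesgue (A \<inter> \<Union>?G)"
      using AG by (simp add: Int_absorb2)
    also have "\<dots> = (\<integral>\<^sup>+S. emeasure lebesgue (A \<inter> S) \<partial>count_space ?G)"
      using A by (intro emeasure_Int_Union_rectangles stopping_rectangles[OF R] stopping_disjoint) auto
    also have "\<dots> \<le> (\<integral>\<^sup>+S. ennreal q * emeasure lebesgue S \<partial>count_space ?G)"
      using small by (intro nn_integral_mono) auto
    also have "\<dots> = ennreal q * emeasure lebesgue (\<Union>?G)"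
      by (subst emeasure_Union_rectangles[OF stopping_rectangles[OF R] stopping_disjoint])
        (simp add: nn_integral_cmult)
    also have "\<dots> \<le> ennreal q * (emeasure lebesgue A + ennreal e)"
    proof (rule mult_left_mono)
      have "emeasure lebesgue (\<Union>?G) \<le> emeasure lebesgue (A \<union> (U - A))"
        using GU A U by (intro emeasure_mono) auto
      also have "\<dots> \<le> emeasure lebesgue A + emeasure lebesgue (U - A)"
        using A U by (intro emeasure_subadditive) auto
      also have "\<dots> \<le> emeasure lebesgue A + ennreal e"
        using U(4) by (intro add_left_mono) simp
      finally show "emeasure lebesgue (\<Union>?G) \<le> emeasure lebesgue A + ennreal e" .
    qed simp
    finally have "ennreal (measure lebesgue A) \<le> ennreal (q * (measure lebesgue A + e))"
      using \<open>e > 0\<close> q by (simp add: emeasure_eq_measure2[OF A] ennreal_mult ennreal_plus)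
    then have "measure lebesgue A \<le> q * (measure lebesgue A + e)"
      using \<open>e > 0\<close> q by (subst (asm) ennreal_le_iff) auto
    also have "\<dots> \<le> q * measure lebesgue A + e"
      using q \<open>e > 0\<close> by (simp add: algebra_simps)
    finally show ?thesis .
  qed
  then have "measure lebesgue A \<le> q * measure lebesgue A"
    by (rule field_le_epsilon)
  then have "(1 - q) * measure lebesgue A \<le> 0" by (simp add: algebra_simps)
  then have "measure lebesgue A = 0"
    using q by (simp add: mult_le_0_iff order.antisym)
  then show ?thesis
    using A unfolding A_def[symmetric] by (simp add: null_sets_def emeasure_eq_measure2 fmeasurableD)
qed

subsection \<open>From small exceptional sets to the mean oscillation\<close>

text \<open>The interface between the hypotheses and the iteration: \<open>osc\<close> is the
  Chebyshev bound for the chosen centers, and \<open>small\<close> is what the two conditions on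
  \<open>a\<close> have in common. The constant in \<open>osc\<close> is \<epsilon> times the
  density threshold of \<open>bad_cells\<close>.\<close>

locale small_oscillation =
  fixes f :: "real ^ 'n \<Rightarrow> real" and a c :: "(real ^ 'n) set \<Rightarrow> real" and \<mu> \<epsilon> :: real
  assumes f: "f \<in> borel_measurable lebesgue"
    and a_pos: "\<And>R. R \<in> rectangles \<Longrightarrow> 0 < a R"
    and mu: "0 < \<mu>" and eps: "0 < \<epsilon>" "\<epsilon> < 1"
    and osc: "\<And>R. R \<in> rectangles \<Longrightarrow>
      measure lebesgue {x \<in> R. \<mu> * a R < \<bar>f x - c R\<bar>} \<le> \<epsilon> / (2 * 2 ^ CARD('n)) * measure lebesgue R"
    and small: "\<And>R F. R \<in> rectangles \<Longrightarrow> F \<subseteq> dyadic_subrectangles R \<Longrightarrow> disjoint F \<Longrightarrow>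
      measure lebesgue (\<Union>F) \<le> \<epsilon> * measure lebesgue R \<Longrightarrow>
      (\<integral>\<^sup>+S. ennreal (a S * measure lebesgue S) \<partial>count_space F) \<le> ennreal (a R * measure lebesgue R / 2)"
begin

definition bad :: "(real ^ 'n) set \<Rightarrow> (real ^ 'n) set" where
  "bad R = {x \<in> R. \<mu> * a R < \<bar>f x - c R\<bar>}"

text \<open>The threshold compensates the factor in \<open>child_measure\<close>: if the parent does
  not exceed it, the cell has density at most one half.\<close>

definition bad_cells :: "(real ^ 'n) set \<Rightarrow> (real ^ 'n) set set" where
  "bad_cells R = stopping R (\<lambda>S. 1 / (2 * 2 ^ CARD('n)) * measure lebesgue S < measure lebesgue (S \<inter> bad R))"

section \<open>The exceptional set and its maximal dense cells\<close>

lemma bad_lmeasurable: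
  assumes "R \<in> rectangles"
  shows "bad R \<in> lmeasurable"
proof (rule fmeasurableI2[OF rectangle_lmeasurable[OF assms]])
  have "{x \<in> space lebesgue. \<mu> * a R < \<bar>f x - c R\<bar>} \<in> sets lebesgue"
    using f by measurable
  then have "R \<inter> {x \<in> space lebesgue. \<mu> * a R < \<bar>f x - c R\<bar>} \<in> sets lebesgue"
    using rectangle_sets[OF assms] by blast
  then show "bad R \<in> sets lebesgue"
    by (simp add: bad_def Collect_conj_eq)
qed (auto simp: bad_def)

lemma bad_cells_rectangles: "R \<in> rectangles \<Longrightarrow> bad_cells R \<subseteq> rectangles"
  by (simp add: bad_cells_def stopping_rectangles)

lemma bad_cells_disjoint: "disjoint (bad_cells R)"
  by (simp add: bad_cells_def stopping_disjoint)

lemma bad_cells_dyadic: "bad_cells R \<subseteq> dyadic_subrectangles R"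
  by (simp add: bad_cells_def stopping_dyadic)

lemma bad_cells_subset: "\<Union>(bad_cells R) \<subseteq> R"
  by (auto simp: bad_cells_def Union_stopping)

lemma bad_outside_cells:
  assumes "R \<in> rectangles"
  shows "bad R - \<Union>(bad_cells R) \<in> null_sets lebesgue"
  unfolding bad_cells_def
proof (rule null_outside_dense_cells[OF assms])
  show "bad R \<in> sets lebesgue" using bad_lmeasurable[OF assms] by blast
  have "(1::real) \<le> 2 ^ CARD('n)" by simp
  then have "1 < 2 * (2::real) ^ CARD('n)" by linarith
  then show "1 / (2 * 2 ^ CARD('n)) < (1::real)" by simp
qed (auto simp: bad_def)

lemma Union_bad_cells_lmeasurable:
  assumes "R \<in> rectangles"
  shows "\<Union>(bad_cells R) \<in> lmeasurable"
  using rectangle_lmeasurable[OF assms] bad_cells_subset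
    sets_Union_rectangles[OF bad_cells_rectangles[OF assms] bad_cells_disjoint]
  by (rule fmeasurableI2)

text \<open>This is the weak type bound for the dyadic maximal function: each of the disjoint cells
  meets \<open>bad R\<close> in more than the proportion \<open>q\<close>, and \<open>q\<close>
  cancels against the constant in \<open>osc\<close>.\<close>

lemma measure_Union_bad_cells:
  assumes R: "R \<in> rectangles"
  shows "measure lebesgue (\<Union>(bad_cells R)) \<le> \<epsilon> * measure lebesgue R"
proof -
  note F = bad_cells_rectangles[OF R] bad_cells_disjoint
  define q :: real where "q = 1 / (2 * 2 ^ CARD('n))"
  have q: "q > 0" by (simp add: q_def)
  have "ennreal (q * measure lebesgue (\<Union>(bad_cells R))) = ennreal q * emeasure lebesgue (\<Union>(bad_cells R))"
    using q by (simp add: emeasure_eq_measure2[OF Union_bad_cells_lmeasurable[OF R]] ennreal_mult)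
  also have "\<dots> = (\<integral>\<^sup>+S. ennreal q * emeasure lebesgue S \<partial>count_space (bad_cells R))"
    by (simp add: emeasure_Union_rectangles[OF F] nn_integral_cmult)
  also have "\<dots> \<le> (\<integral>\<^sup>+S. emeasure lebesgue (bad R \<inter> S) \<partial>count_space (bad_cells R))"
  proof (rule nn_integral_mono)
    fix S assume "S \<in> space (count_space (bad_cells R))"
    then have S: "S \<in> bad_cells R" by simp
    then have Sr: "S \<in> rectangles" using F by blast
    have "bad R \<inter> S \<in> lmeasurable"
      using bad_lmeasurable[OF R] rectangle_sets[OF Sr] by (rule fmeasurable_Int_fmeasurable)
    moreover have "q * measure lebesgue S \<le> measure lebesgue (bad R \<inter> S)"
      using S unfolding bad_cells_def by (auto elim!: stoppingE simp: q_def Int_commute)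
    ultimately show "ennreal q * emeasure lebesgue S \<le> emeasure lebesgue (bad R \<inter> S)"
      using q by (simp add: emeasure_eq_measure2 emeasure_rectangle[OF Sr] ennreal_mult[symmetric] ennreal_leI)
  qed
  also have "\<dots> = emeasure lebesgue (bad R \<inter> \<Union>(bad_cells R))"
    using bad_lmeasurable[OF R] by (intro emeasure_Int_Union_rectangles[OF F, symmetric]) blast
  also have "\<dots> \<le> emeasure lebesgue (bad R)"
    using bad_lmeasurable[OF R] by (intro emeasure_mono) auto
  also have "\<dots> = ennreal (measure lebesgue (bad R))"
    using bad_lmeasurable[OF R] by (rule emeasure_eq_measure2)
  finally have "q * measure lebesgue (\<Union>(bad_cells R)) \<le> measure lebesgue (bad R)"
    by (subst (asm) ennreal_le_iff) auto
  also have "\<dots> \<le> q * (\<epsilon> * measure lebesgue R)"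
    using osc[OF R] by (simp add: bad_def q_def)
  finally show ?thesis using q by simp
qed

text \<open>Some point of \<open>S\<close> lies outside both \<open>bad R\<close> and
  \<open>bad S\<close>, and there \<open>f\<close> is close to both centers. The set
  \<open>bad R\<close> fills at most half of \<open>S\<close> because the parent of \<open>S\<close>
  is not dense.\<close>

lemma center_diff:
  assumes R: "R \<in> rectangles" and S: "S \<in> bad_cells R"
  shows "\<bar>c S - c R\<bar> \<le> \<mu> * (a R + a S)"
proof -
  have Sr: "S \<in> rectangles" using bad_cells_rectangles[OF R] S by blast
  from S show ?thesis unfolding bad_cells_def
  proof (cases rule: stoppingE)
    case 1
    then show ?thesis using a_pos[OF R] mu by simp
  next
    case (2 j x)
    define T where "T = cell R j x"
    have T: "T \<in> rectangles" "S = child T x" "S \<subseteq> T"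
      using 2(2) cell_rectangle[OF R] by (simp_all add: T_def child_def)
    have meas: "S \<inter> bad R \<in> lmeasurable" "T \<inter> bad R \<in> lmeasurable" "bad S \<in> lmeasurable"
      using rectangle_lmeasurable[OF Sr] rectangle_lmeasurable[OF T(1)] bad_lmeasurable[OF R] bad_lmeasurable[OF Sr]
      by (simp_all add: fmeasurable.Int)
    have pos: "measure lebesgue S > 0" by (rule rectangle_measure_pos[OF Sr])
    have "measure lebesgue (S \<inter> bad R) \<le> measure lebesgue (T \<inter> bad R)"
      using meas T by (intro measure_mono_fmeasurable) auto
    also have "\<dots> \<le> measure lebesgue T / (2 * 2 ^ CARD('n))"
      using 2 by (simp add: T_def)
    also have "\<dots> = measure lebesgue S / 2"
      unfolding child_measure[OF T(1), of x] T(2) by simp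
    finally have 1: "measure lebesgue (S \<inter> bad R) \<le> measure lebesgue S / 2" .
    have "(1::real) \<le> 2 ^ CARD('n)" by simp
    then have "\<epsilon> < 2 ^ CARD('n)" using eps by linarith
    \<comment> \<open>Strictness matters: \<open>bad R\<close> may fill half of \<open>S\<close>, so
      \<open>bad S\<close> has to fill less than the other half.\<close>
    then have "\<epsilon> / (2 * 2 ^ CARD('n)) < 1 / 2" by (simp add: field_simps)
    then have 2: "measure lebesgue (bad S) < measure lebesgue S / 2"
      using osc[OF Sr] pos mult_strict_right_mono[of "\<epsilon> / (2 * 2 ^ CARD('n))" "1/2" "measure lebesgue S"]
      by (simp add: bad_def)
    have "\<not> S \<subseteq> S \<inter> bad R \<union> bad S"
    proof
      assume "S \<subseteq> S \<inter> bad R \<union> bad S"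
      then have "measure lebesgue S \<le> measure lebesgue (S \<inter> bad R \<union> bad S)"
        using meas rectangle_lmeasurable[OF Sr] by (intro measure_mono_fmeasurable) auto
      also have "\<dots> \<le> measure lebesgue (S \<inter> bad R) + measure lebesgue (bad S)"
        using meas by (intro measure_Un_le) auto
      finally show False using 1 2 by simp
    qed
    then obtain y where "y \<in> S" "y \<notin> bad R" "y \<notin> bad S" by blast
    then have "\<bar>f y - c R\<bar> \<le> \<mu> * a R" "\<bar>f y - c S\<bar> \<le> \<mu> * a S"
      using T(3) cell_subset[of R j x] by (auto simp: bad_def T_def not_less)
    then show ?thesis by (simp add: algebra_simps abs_le_iff)
  qed
qed

text \<open>Off the cells \<open>\<mu> * a R\<close> bounds the integrand almost everywhere. On a
  cell \<open>S\<close> the estimate for \<open>S\<close> is used, and the change of center costs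
  \<open>\<mu> * (a R + a S)\<close>. The terms with \<open>a S\<close> then carry the factor
  \<open>5 + 1 = 6\<close>, which \<open>small\<close> halves, while \<open>B\<close> only meets the
  total measure of the cells and so gains the factor \<epsilon>.\<close>

lemma truncated_oscillation_step:
  assumes R: "R \<in> rectangles" and M: "0 \<le> M" and B: "0 \<le> B"
    and IH: "\<And>S. S \<in> rectangles \<Longrightarrow>
      (\<integral>\<^sup>+x\<in>S. ennreal (min \<bar>f x - c S\<bar> M) \<partial>lebesgue) \<le> ennreal ((5 * \<mu> * a S + B) * measure lebesgue S)"
  shows "(\<integral>\<^sup>+x\<in>R. ennreal (min \<bar>f x - c R\<bar> M) \<partial>lebesgue) \<le> ennreal ((5 * \<mu> * a R + \<epsilon> * B) * measure lebesgue R)"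
proof -
  let ?F = "bad_cells R" and ?m = "measure lebesgue"
  note F = bad_cells_rectangles[OF R] bad_cells_disjoint
  have [measurable]: "f \<in> borel_measurable lebesgue" by (rule f)
  have UF[measurable]: "\<Union>?F \<in> sets lebesgue" by (rule sets_Union_rectangles[OF F])
  have Rs[measurable]: "R \<in> sets lebesgue" by (rule rectangle_sets[OF R])
  have aR: "0 < a R" by (rule a_pos[OF R])
  have cell_bound: "(\<integral>\<^sup>+x\<in>S. ennreal (min \<bar>f x - c R\<bar> M) \<partial>lebesgue)
      \<le> ennreal (6 * \<mu>) * ennreal (a S * ?m S) + ennreal (B + \<mu> * a R) * emeasure lebesgue S"
    if S: "S \<in> ?F" for S
  proof -
    have Sr: "S \<in> rectangles" using F S by blast
    note [measurable] = rectangle_sets[OF Sr]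
    have aS: "0 < a S" by (rule a_pos[OF Sr])
    let ?d = "\<mu> * (a R + a S)"
    have d: "?d \<ge> 0" using mu aR aS by simp
    have "(\<integral>\<^sup>+x\<in>S. ennreal (min \<bar>f x - c R\<bar> M) \<partial>lebesgue)
        \<le> (\<integral>\<^sup>+x. ennreal (min \<bar>f x - c S\<bar> M) * indicator S x + ennreal ?d * indicator S x \<partial>lebesgue)"
    proof (rule nn_integral_mono)
      fix x
      have "min \<bar>f x - c R\<bar> M \<le> min \<bar>f x - c S\<bar> M + ?d"
        using center_diff[OF R S] d M by linarith
      then have "ennreal (min \<bar>f x - c R\<bar> M) \<le> ennreal (min \<bar>f x - c S\<bar> M) + ennreal ?d"
        using d M by (simp add: ennreal_plus[symmetric] ennreal_leI del: ennreal_plus)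
      then show "ennreal (min \<bar>f x - c R\<bar> M) * indicator S x
          \<le> ennreal (min \<bar>f x - c S\<bar> M) * indicator S x + ennreal ?d * indicator S x"
        by (simp split: split_indicator)
    qed
    also have "\<dots> = (\<integral>\<^sup>+x\<in>S. ennreal (min \<bar>f x - c S\<bar> M) \<partial>lebesgue) + ennreal ?d * emeasure lebesgue S"
      by (subst nn_integral_add) (auto simp: nn_integral_cmult_indicator)
    also have "\<dots> \<le> ennreal ((5 * \<mu> * a S + B) * ?m S) + ennreal ?d * emeasure lebesgue S"
      by (intro add_right_mono IH Sr)
    also have "\<dots> = ennreal ((5 * \<mu> * a S + B) * ?m S + ?d * ?m S)"
      using d mu aS B by (simp add: emeasure_rectangle[OF Sr] ennreal_mult[symmetric] ennreal_plus[symmetric] del: ennreal_plus)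
    also have "(5 * \<mu> * a S + B) * ?m S + ?d * ?m S = 6 * \<mu> * (a S * ?m S) + (B + \<mu> * a R) * ?m S"
      by (simp add: algebra_simps)
    also have "ennreal \<dots> = ennreal (6 * \<mu>) * ennreal (a S * ?m S) + ennreal (B + \<mu> * a R) * emeasure lebesgue S"
      using mu aS aR B by (simp add: emeasure_rectangle[OF Sr] ennreal_mult[symmetric] ennreal_plus[symmetric] del: ennreal_plus)
    finally show ?thesis .
  qed
  have "AE x in lebesgue. x \<notin> bad R - \<Union>?F"
    by (rule AE_not_in[OF bad_outside_cells[OF R]])
  then have "(\<integral>\<^sup>+x\<in>R. ennreal (min \<bar>f x - c R\<bar> M) \<partial>lebesgue)
      \<le> (\<integral>\<^sup>+x. ennreal (\<mu> * a R) * indicator R x + ennreal (min \<bar>f x - c R\<bar> M) * indicator (\<Union>?F) x \<partial>lebesgue)"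
  proof (intro nn_integral_mono_AE, elim AE_mp, intro AE_I2 impI)
    fix x assume x: "x \<notin> bad R - \<Union>?F"
    show "ennreal (min \<bar>f x - c R\<bar> M) * indicator R x \<le>
        ennreal (\<mu> * a R) * indicator R x + ennreal (min \<bar>f x - c R\<bar> M) * indicator (\<Union>?F) x"
    proof (cases "x \<in> \<Union>?F \<or> x \<notin> R")
      case True
      then show ?thesis by (auto simp: indicator_def)
    next
      case False
      then have "min \<bar>f x - c R\<bar> M \<le> \<mu> * a R" using x by (auto simp: bad_def)
      then show ?thesis using False by (simp add: ennreal_leI)
    qed
  qed
  also have "\<dots> = ennreal (\<mu> * a R) * emeasure lebesgue R + (\<integral>\<^sup>+x\<in>\<Union>?F. ennreal (min \<bar>f x - c R\<bar> M) \<partial>lebesgue)"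
    by (subst nn_integral_add) (auto simp: nn_integral_cmult_indicator)
  also have "(\<integral>\<^sup>+x\<in>\<Union>?F. ennreal (min \<bar>f x - c R\<bar> M) \<partial>lebesgue)
      = (\<integral>\<^sup>+S. (\<integral>\<^sup>+x\<in>S. ennreal (min \<bar>f x - c R\<bar> M) \<partial>lebesgue) \<partial>count_space ?F)"
    by (rule nn_integral_Union_rectangles[OF F]) measurable
  also have "\<dots> \<le> (\<integral>\<^sup>+S. ennreal (6 * \<mu>) * ennreal (a S * ?m S) + ennreal (B + \<mu> * a R) * emeasure lebesgue S \<partial>count_space ?F)"
    using cell_bound by (intro nn_integral_mono) auto
  also have "\<dots> = ennreal (6 * \<mu>) * (\<integral>\<^sup>+S. ennreal (a S * ?m S) \<partial>count_space ?F)
      + ennreal (B + \<mu> * a R) * emeasure lebesgue (\<Union>?F)"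
    by (simp add: nn_integral_add nn_integral_cmult emeasure_Union_rectangles[OF F])
  also have "\<dots> \<le> ennreal (6 * \<mu>) * ennreal (a R * ?m R / 2) + ennreal (B + \<mu> * a R) * ennreal (\<epsilon> * ?m R)"
    using measure_Union_bad_cells[OF R]
    by (intro add_mono mult_left_mono small[OF R bad_cells_dyadic bad_cells_disjoint])
      (auto simp: emeasure_eq_measure2[OF Union_bad_cells_lmeasurable[OF R]] intro!: ennreal_leI)
  also have "ennreal (\<mu> * a R) * emeasure lebesgue R + (ennreal (6 * \<mu>) * ennreal (a R * ?m R / 2) + ennreal (B + \<mu> * a R) * ennreal (\<epsilon> * ?m R))
      = ennreal (\<mu> * a R * ?m R + (6 * \<mu> * (a R * ?m R / 2) + (B + \<mu> * a R) * (\<epsilon> * ?m R)))"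
    using mu aR B eps by (simp add: emeasure_rectangle[OF R] ennreal_mult[symmetric] ennreal_plus[symmetric] del: ennreal_plus)
  also have "\<dots> \<le> ennreal ((5 * \<mu> * a R + \<epsilon> * B) * ?m R)"
  proof (rule ennreal_leI)
    \<comment> \<open>This accounts for the constant 5: one unit from outside the cells, three from
      the sum of the \<open>a S\<close>, and at most one from \<open>\<mu> * a R\<close> on the
      cells.\<close>
    have "\<epsilon> * (\<mu> * a R * ?m R) \<le> 1 * (\<mu> * a R * ?m R)"
      using eps mu aR by (intro mult_right_mono) auto
    then show "\<mu> * a R * ?m R + (6 * \<mu> * (a R * ?m R / 2) + (B + \<mu> * a R) * (\<epsilon> * ?m R)) \<le> (5 * \<mu> * a R + \<epsilon> * B) * ?m R"
      by (simp add: algebra_simps)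
  qed
  finally show ?thesis by (simp add: add_left_mono)
qed

text \<open>The truncation supplies the start of the induction, the trivial bound by
  \<open>M\<close>. The induction runs over all rectangles at once, since the step for
  \<open>R\<close> refers to its subrectangles.\<close>

lemma truncated_oscillation:
  assumes M: "0 \<le> M" and "R \<in> rectangles"
  shows "(\<integral>\<^sup>+x\<in>R. ennreal (min \<bar>f x - c R\<bar> M) \<partial>lebesgue)
    \<le> ennreal ((5 * \<mu> * a R + \<epsilon> ^ k * M) * measure lebesgue R)"
  using assms(2)
proof (induction k arbitrary: R)
  case 0
  have "(\<integral>\<^sup>+x\<in>R. ennreal (min \<bar>f x - c R\<bar> M) \<partial>lebesgue) \<le> (\<integral>\<^sup>+x. ennreal M * indicator R x \<partial>lebesgue)"
    by (intro nn_integral_mono mult_right_mono ennreal_leI) auto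
  also have "\<dots> = ennreal (M * measure lebesgue R)"
    using M by (simp add: nn_integral_cmult_indicator rectangle_sets[OF 0] emeasure_rectangle[OF 0] ennreal_mult)
  also have "\<dots> \<le> ennreal ((5 * \<mu> * a R + \<epsilon> ^ 0 * M) * measure lebesgue R)"
    using mu a_pos[OF 0] by (intro ennreal_leI mult_right_mono) auto
  finally show ?case .
next
  case (Suc k)
  then show ?case
    using truncated_oscillation_step[OF Suc.prems M, of "\<epsilon> ^ k * M"] M eps by (simp add: mult.assoc)
qed

text \<open>For fixed \<open>M\<close>, letting \<open>k\<close> tend to infinity removes the term
  with \<open>M\<close>. The resulting bound is uniform in \<open>M\<close>, so monotone convergence
  removes the truncation.\<close>

theorem mean_oscillation:
  assumes R: "R \<in> rectangles"
  shows "(\<integral>\<^sup>+x\<in>R. ennreal \<bar>f x - c R\<bar> \<partial>lebesgue) \<le> ennreal (5 * \<mu> * a R * measure lebesgue R)"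
proof -
  have [measurable]: "f \<in> borel_measurable lebesgue" "R \<in> sets lebesgue"
    by (rule f, rule rectangle_sets[OF R])
  have trunc: "(\<integral>\<^sup>+x\<in>R. ennreal (min \<bar>f x - c R\<bar> (real M)) \<partial>lebesgue) \<le> ennreal (5 * \<mu> * a R * measure lebesgue R)" for M
  proof (rule LIMSEQ_le_const)
    have "(\<lambda>k. (5 * \<mu> * a R + \<epsilon> ^ k * real M) * measure lebesgue R) \<longlonglongrightarrow> (5 * \<mu> * a R + 0 * real M) * measure lebesgue R"
      using eps by (intro tendsto_intros LIMSEQ_power_zero) auto
    then show "(\<lambda>k. ennreal ((5 * \<mu> * a R + \<epsilon> ^ k * real M) * measure lebesgue R)) \<longlonglongrightarrow> ennreal (5 * \<mu> * a R * measure lebesgue R)"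
      by (intro tendsto_ennrealI) simp
  qed (use truncated_oscillation[OF _ R] in auto)
  have "(\<lambda>M. \<integral>\<^sup>+x\<in>R. ennreal (min \<bar>f x - c R\<bar> (real M)) \<partial>lebesgue) \<longlonglongrightarrow> (\<integral>\<^sup>+x\<in>R. ennreal \<bar>f x - c R\<bar> \<partial>lebesgue)"
  proof (rule nn_integral_LIMSEQ)
    show "incseq (\<lambda>M x. ennreal (min \<bar>f x - c R\<bar> (real M)) * indicator R x)"
      by (auto simp: incseq_def le_fun_def intro!: mult_right_mono ennreal_leI)
    show "(\<lambda>M. ennreal (min \<bar>f x - c R\<bar> (real M)) * indicator R x) \<longlonglongrightarrow> ennreal \<bar>f x - c R\<bar> * indicator R x" for x
    proof (rule tendsto_eventually)
      obtain N :: nat where "\<bar>f x - c R\<bar> \<le> real N" using real_arch_simple by blast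
      then show "\<forall>\<^sub>F M in sequentially. ennreal (min \<bar>f x - c R\<bar> (real M)) * indicator R x = ennreal \<bar>f x - c R\<bar> * indicator R x"
        by (intro eventually_sequentiallyI[of N]) (simp add: min_def)
    qed
  qed measurable
  then show ?thesis
    by (rule LIMSEQ_le_const2) (use trunc in auto)
qed

end

subsection \<open>The two conditions on the functional\<close>

lemma dyadic_children_eq_child:
  assumes "T \<in> dyadic_children S"
  obtains x where "T = child S x"
proof -
  obtain A where T: "T = {x \<in> S. \<forall>i. if i \<in> A then x $ i < midpt S i else midpt S i \<le> x $ i}"
    using assms by (auto simp: dyadic_children_def)
  \<comment> \<open>The midpoint belongs to the upper half, so lowering it exactly in the
    coordinates of \<open>A\<close> encodes \<open>A\<close> by a point.\<close>
  define x where "x = (\<chi> i. if i \<in> A then midpt S i - 1 else midpt S i)"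
  have "(if i \<in> A then y $ i < midpt S i else midpt S i \<le> y $ i) \<longleftrightarrow> (y $ i < midpt S i \<longleftrightarrow> x $ i < midpt S i)" for y i
    by (cases "i \<in> A") (simp_all add: x_def not_less)
  then have "T = child S x" unfolding T child_def by simp
  then show ?thesis by (rule that)
qed

lemma dyadic_subrectangles_rectangles:
  assumes "R \<in> rectangles"
  shows "dyadic_subrectangles R \<subseteq> rectangles"
proof
  fix S assume "S \<in> dyadic_subrectangles R"
  then show "S \<in> rectangles"
    by induction (use assms in \<open>auto elim!: dyadic_children_eq_child intro: child_rectangle\<close>)
qed

text \<open>It links the unordered sums in the conditions on \<open>a\<close> with the counting
  integrals used here. Partial sums along an enumeration of \<open>F\<close> are finite subsums, and
  \<open>infsum\<close> is the supremum of these.\<close>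

lemma nn_integral_count_space_le_infsum:
  fixes g :: "'a \<Rightarrow> ennreal"
  assumes "countable F"
  shows "(\<integral>\<^sup>+S. g S \<partial>count_space F) \<le> infsum g F"
proof (cases "finite F")
  case True
  then show ?thesis by (simp add: nn_integral_count_space_finite)
next
  case False
  let ?h = "from_nat_into F"
  have bij: "bij_betw ?h UNIV F" using assms False by (rule bij_betw_from_nat_into)
  have "(\<integral>\<^sup>+S. g S \<partial>count_space F) = (\<Sum>i. g (?h i))"
    by (simp add: nn_integral_bij_count_space[OF bij, symmetric] nn_integral_count_space_nat)
  also have "\<dots> \<le> infsum g F"
  proof (rule suminf_le_const)
    fix n
    have "(\<Sum>i<n. g (?h i)) = sum g (?h ` {..<n})"
      using bij by (subst sum.reindex) (auto simp: bij_betw_def intro: inj_on_subset)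
    also have "\<dots> \<le> infsum g F"
      using bij by (subst nonneg_infsum_complete) (auto simp: bij_betw_def intro!: SUP_upper)
    finally show "(\<Sum>i<n. g (?h i)) \<le> infsum g F" .
  qed simp
  finally show ?thesis .
qed

text \<open>The power of \<infinity> is \<infinity>, so a finite bound forces \<open>X\<close> to be
  finite and the claim reduces to real powers.\<close>

lemma ennreal_powr_leD:
  assumes "ennreal_powr X (1 / r) \<le> ennreal y" "0 < r" "0 \<le> y"
  shows "X \<le> ennreal (y powr r)"
proof -
  have "X \<noteq> \<infinity>" using assms(1) by (auto simp: ennreal_powr_def top_unique)
  then have fin: "enn2real X powr (1 / r) \<le> y"
    using assms by (simp add: ennreal_powr_def)
  then have "(enn2real X powr (1 / r)) powr r \<le> y powr r"
    using assms(2) by (intro powr_mono2) auto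
  then have "enn2real X \<le> y powr r"
    using assms(2) by (simp add: powr_powr)
  have "X = ennreal (enn2real X)"
    using \<open>X \<noteq> \<infinity>\<close> by (simp add: less_top)
  also have "\<dots> \<le> ennreal (y powr r)"
    using \<open>enn2real X \<le> y powr r\<close> by (rule ennreal_leI)
  finally show ?thesis .
qed

text \<open>For \<open>a > t\<close> the negative exponent gives
  \<open>a powr (1 - p) \<le> t powr (1 - p)\<close>. Cutting at height \<open>t\<close> in this way
  takes the place of the Hoelder inequality.\<close>

lemma le_add_powr:
  fixes a t p :: real
  assumes "0 < a" "0 < t" "1 < p"
  shows "a \<le> t + t powr (1 - p) * a powr p"
proof (cases "a \<le> t")
  case True
  moreover have "0 \<le> t powr (1 - p) * a powr p" by simp
  ultimately show ?thesis by linarith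
next
  case False
  have "a = a powr (1 - p) * a powr p"
    using assms by (simp flip: powr_add)
  also have "\<dots> \<le> t powr (1 - p) * a powr p"
    using assms False by (intro mult_right_mono powr_mono2') auto
  finally show ?thesis using assms by linarith
qed

text \<open>The values \<open>a S\<close> are cut at height \<open>t = \<tau> * a R\<close>. The low
  part is controlled by the measure of the union, the high part by the sum of \<open>p\<close>-th
  powers, and each contributes a quarter of \<open>a R * measure lebesgue R\<close>.\<close>

lemma Dp_small:
  fixes a :: "(real ^ 'n) set \<Rightarrow> real"
  assumes a_pos: "\<And>R. R \<in> rectangles \<Longrightarrow> 0 < a R" and p: "1 < p"
    and Dp: "Dp_bound p a K0" and K: "K0 \<le> K" "1 \<le> K"
    and R: "R \<in> rectangles" and F: "F \<subseteq> dyadic_subrectangles R" "disjoint F"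
    and U: "measure lebesgue (\<Union>F) \<le> 1 / (4 * (4 * K powr p) powr (1 / (p - 1))) * measure lebesgue R"
  shows "(\<integral>\<^sup>+S. ennreal (a S * measure lebesgue S) \<partial>count_space F) \<le> ennreal (a R * measure lebesgue R / 2)"
proof -
  let ?m = "measure lebesgue"
  have Fr: "F \<subseteq> rectangles" using F dyadic_subrectangles_rectangles[OF R] by blast
  have aR: "0 < a R" by (rule a_pos[OF R])
  have mR: "0 < ?m R" by (rule rectangle_measure_pos[OF R])
  \<comment> \<open>Chosen such that \<open>\<tau> powr (1 - p) * K powr p = 1 / 4\<close>; the
    measure bound on the union is \<open>1 / (4 * \<tau>)\<close> times the measure of
    \<open>R\<close>.\<close>
  define \<tau> where "\<tau> = (4 * K powr p) powr (1 / (p - 1))"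
  have \<tau>: "\<tau> > 0" using K by (simp add: \<tau>_def)
  have \<tau>p: "\<tau> powr (1 - p) = 1 / (4 * K powr p)"
  proof -
    have "\<tau> powr (1 - p) = (4 * K powr p) powr (1 / (p - 1) * (1 - p))"
      unfolding \<tau>_def by (rule powr_powr)
    also have "1 / (p - 1) * (1 - p) = - 1"
      using p by (simp add: field_simps)
    finally show ?thesis using K by (simp add: powr_minus_divide)
  qed
  define t where "t = \<tau> * a R"
  have t: "t > 0" using \<tau> aR by (simp add: t_def)
  have "S \<subseteq> R" if "S \<in> dyadic_subrectangles R" for S
    using that by induction (auto simp: dyadic_children_def)
  then have "\<Union>F \<subseteq> R" using F by blast
  then have Ul: "\<Union>F \<in> lmeasurable"
    using rectangle_lmeasurable[OF R] sets_Union_rectangles[OF Fr F(2)] by (blast intro: fmeasurableI2)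
  have "ennreal_powr (\<Sum>\<^sub>\<infinity>S\<in>F. ennreal (a S powr p * (?m S / ?m R))) (1 / p) \<le> ennreal (K0 * a R)"
    using Dp R F unfolding Dp_bound_def by blast
  also have "\<dots> \<le> ennreal (K * a R)"
    using K aR by (intro ennreal_leI mult_right_mono) auto
  finally have "(\<Sum>\<^sub>\<infinity>S\<in>F. ennreal (a S powr p * (?m S / ?m R))) \<le> ennreal ((K * a R) powr p)"
    using p K aR by (intro ennreal_powr_leD) auto
  then have sum_p: "(\<integral>\<^sup>+S. ennreal (a S powr p * (?m S / ?m R)) \<partial>count_space F) \<le> ennreal ((K * a R) powr p)"
    using nn_integral_count_space_le_infsum[OF countable_disjoint_rectangles[OF Fr F(2)]] order.trans by blast
  have "(\<integral>\<^sup>+S. ennreal (a S * ?m S) \<partial>count_space F)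
      \<le> (\<integral>\<^sup>+S. ennreal t * emeasure lebesgue S
          + ennreal (t powr (1 - p) * ?m R) * ennreal (a S powr p * (?m S / ?m R)) \<partial>count_space F)"
  proof (rule nn_integral_mono)
    fix S assume "S \<in> space (count_space F)"
    then have Sr: "S \<in> rectangles" using Fr by auto
    have "a S * ?m S \<le> (t + t powr (1 - p) * a S powr p) * ?m S"
      using le_add_powr[OF a_pos[OF Sr] t p] by (intro mult_right_mono) auto
    also have "\<dots> = t * ?m S + (t powr (1 - p) * ?m R) * (a S powr p * (?m S / ?m R))"
      using mR by (simp add: algebra_simps)
    finally have "ennreal (a S * ?m S) \<le> ennreal (t * ?m S + (t powr (1 - p) * ?m R) * (a S powr p * (?m S / ?m R)))"
      by (rule ennreal_leI)
    also have "\<dots> = ennreal t * emeasure lebesgue S + ennreal (t powr (1 - p) * ?m R) * ennreal (a S powr p * (?m S / ?m R))"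
      using t mR by (simp add: emeasure_rectangle[OF Sr] ennreal_mult[symmetric] ennreal_plus[symmetric] del: ennreal_plus)
    finally show "ennreal (a S * ?m S) \<le> ennreal t * emeasure lebesgue S
          + ennreal (t powr (1 - p) * ?m R) * ennreal (a S powr p * (?m S / ?m R))" .
  qed
  also have "\<dots> = ennreal t * emeasure lebesgue (\<Union>F)
      + ennreal (t powr (1 - p) * ?m R) * (\<integral>\<^sup>+S. ennreal (a S powr p * (?m S / ?m R)) \<partial>count_space F)"
    by (simp add: nn_integral_add nn_integral_cmult emeasure_Union_rectangles[OF Fr F(2)])
  also have "\<dots> \<le> ennreal t * ennreal (1 / (4 * \<tau>) * ?m R) + ennreal (t powr (1 - p) * ?m R) * ennreal ((K * a R) powr p)"
    using U sum_p by (intro add_mono mult_left_mono) (auto simp: emeasure_eq_measure2[OF Ul] \<tau>_def intro!: ennreal_leI)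
  also have "\<dots> = ennreal (t * (1 / (4 * \<tau>) * ?m R) + t powr (1 - p) * ?m R * (K * a R) powr p)"
    using t \<tau> mR by (simp add: ennreal_mult[symmetric] ennreal_plus[symmetric] del: ennreal_plus)
  also have "t * (1 / (4 * \<tau>) * ?m R) + t powr (1 - p) * ?m R * (K * a R) powr p = a R * ?m R / 2"
  proof -
    have "t powr (1 - p) * (K * a R) powr p = \<tau> powr (1 - p) * K powr p * (a R powr (1 - p) * a R powr p)"
      using \<tau> aR K by (simp add: t_def powr_mult)
    also have "\<dots> = a R / 4"
      using aR K by (simp add: \<tau>p flip: powr_add)
    finally have "t powr (1 - p) * ?m R * (K * a R) powr p = a R / 4 * ?m R"
      by (simp add: algebra_simps)
    moreover have "t * (1 / (4 * \<tau>) * ?m R) = a R / 4 * ?m R"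
      using \<tau> by (simp add: t_def)
    ultimately show ?thesis by linarith
  qed
  finally show ?thesis .
qed

text \<open>The bound on the union is the \<open>s\<close>-th power of \<open>1 / (2 * K)\<close>,
  so the power \<open>1 / s\<close> in the condition yields \<open>1 / (2 * K)\<close> and the
  constant \<open>K\<close> cancels to one half.\<close>

lemma SD1_small:
  fixes a :: "(real ^ 'n) set \<Rightarrow> real"
  assumes a_pos: "\<And>R. R \<in> rectangles \<Longrightarrow> 0 < a R" and s: "0 < s"
    and SD: "SD1_bound s a K0" and K: "K0 \<le> K" "1 \<le> K"
    and R: "R \<in> rectangles" and F: "F \<subseteq> dyadic_subrectangles R" "disjoint F"
    and U: "measure lebesgue (\<Union>F) \<le> (1 / (2 * K)) powr s * measure lebesgue R"
  shows "(\<integral>\<^sup>+S. ennreal (a S * measure lebesgue S) \<partial>count_space F) \<le> ennreal (a R * measure lebesgue R / 2)"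
proof -
  let ?m = "measure lebesgue"
  have Fr: "F \<subseteq> rectangles" using F dyadic_subrectangles_rectangles[OF R] by blast
  have aR: "0 < a R" by (rule a_pos[OF R])
  have mR: "0 < ?m R" by (rule rectangle_measure_pos[OF R])
  have "?m (\<Union>F) / ?m R \<le> (1 / (2 * K)) powr s"
    using U mR by (simp add: field_simps)
  then have "(?m (\<Union>F) / ?m R) powr (1 / s) \<le> ((1 / (2 * K)) powr s) powr (1 / s)"
    using s by (intro powr_mono2) auto
  also have "\<dots> = 1 / (2 * K)"
    using s K by (simp add: powr_powr)
  finally have X: "(?m (\<Union>F) / ?m R) powr (1 / s) \<le> 1 / (2 * K)" .
  have "K0 * (?m (\<Union>F) / ?m R) powr (1 / s) \<le> K * (1 / (2 * K))"
    using X K by (intro mult_mono) auto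
  then have K0: "K0 * (?m (\<Union>F) / ?m R) powr (1 / s) * a R \<le> 1 / 2 * a R"
    using aR K by (intro mult_right_mono) auto
  have "(\<integral>\<^sup>+S. ennreal (a S * (?m S / ?m R)) \<partial>count_space F) \<le> (\<Sum>\<^sub>\<infinity>S\<in>F. ennreal (a S * (?m S / ?m R)))"
    by (intro nn_integral_count_space_le_infsum countable_disjoint_rectangles Fr F)
  also have "\<dots> \<le> ennreal (K0 * (?m (\<Union>F) / ?m R) powr (1 / s) * a R)"
    using SD R F unfolding SD1_bound_def by blast
  also have "\<dots> \<le> ennreal (1 / 2 * a R)"
    using K0 by (rule ennreal_leI)
  finally have le: "(\<integral>\<^sup>+S. ennreal (a S * (?m S / ?m R)) \<partial>count_space F) \<le> ennreal (1 / 2 * a R)" .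
  have "(\<integral>\<^sup>+S. ennreal (a S * ?m S) \<partial>count_space F)
      = (\<integral>\<^sup>+S. ennreal (?m R) * ennreal (a S * (?m S / ?m R)) \<partial>count_space F)"
    using mR by (intro nn_integral_cong) (simp add: ennreal_mult'[symmetric])
  also have "\<dots> = ennreal (?m R) * (\<integral>\<^sup>+S. ennreal (a S * (?m S / ?m R)) \<partial>count_space F)"
    by (simp add: nn_integral_cmult)
  also have "\<dots> \<le> ennreal (?m R) * ennreal (1 / 2 * a R)"
    using le by (rule mult_left_mono) simp
  also have "\<dots> = ennreal (a R * ?m R / 2)"
    using mR by (simp add: ennreal_mult'[symmetric] mult.commute)
  finally show ?thesis .
qed

text \<open>Some \<open>c\<close> has oscillation below \<open>2 * \<alpha>\<close>, and Chebyshev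
  at height \<open>\<mu> * \<alpha>\<close> for the power \<delta> gives the ratio
  \<open>(2 / \<mu>) powr \<delta>\<close>.\<close>

lemma near_optimal_center:
  fixes f :: "real ^ 'n \<Rightarrow> real"
  assumes f: "f \<in> borel_measurable lebesgue" and \<delta>: "0 < \<delta>" and R: "R \<in> rectangles"
    and \<alpha>: "0 < \<alpha>" and \<mu>: "0 < \<mu>"
    and osc: "(INF c :: real. ennreal_powr
             ((\<integral>\<^sup>+x\<in>R. ennreal (\<bar>f x - c\<bar> powr \<delta>) \<partial>lebesgue) / emeasure lebesgue R) (1 / \<delta>)) \<le> ennreal \<alpha>"
  shows "\<exists>c. measure lebesgue {x \<in> R. \<mu> * \<alpha> < \<bar>f x - c\<bar>} \<le> (2 / \<mu>) powr \<delta> * measure lebesgue R"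
proof -
  let ?m = "measure lebesgue R"
  have m: "0 < ?m" by (rule rectangle_measure_pos[OF R])
  have [measurable]: "f \<in> borel_measurable lebesgue" "R \<in> sets lebesgue"
    by (rule f, rule rectangle_sets[OF R])
  note osc
  \<comment> \<open>The infimum may not be attained; as \<open>\<alpha> > 0\<close>, doubling leaves
    room for an actual center.\<close>
  also have "ennreal \<alpha> < ennreal (2 * \<alpha>)" using \<alpha> by (intro ennreal_lessI) auto
  finally obtain c where "ennreal_powr
      ((\<integral>\<^sup>+x\<in>R. ennreal (\<bar>f x - c\<bar> powr \<delta>) \<partial>lebesgue) / emeasure lebesgue R) (1 / \<delta>) < ennreal (2 * \<alpha>)"
    unfolding INF_less_iff by blast
  then have "(\<integral>\<^sup>+x\<in>R. ennreal (\<bar>f x - c\<bar> powr \<delta>) \<partial>lebesgue) / ennreal ?m \<le> ennreal ((2 * \<alpha>) powr \<delta>)"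
    using \<delta> \<alpha> by (intro ennreal_powr_leD) (auto simp: emeasure_rectangle[OF R, symmetric])
  then have "(\<integral>\<^sup>+x\<in>R. ennreal (\<bar>f x - c\<bar> powr \<delta>) \<partial>lebesgue) / ennreal ?m * ennreal ?m \<le> ennreal ((2 * \<alpha>) powr \<delta>) * ennreal ?m"
    by (rule mult_right_mono) simp
  then have int: "(\<integral>\<^sup>+x\<in>R. ennreal (\<bar>f x - c\<bar> powr \<delta>) \<partial>lebesgue) \<le> ennreal ((2 * \<alpha>) powr \<delta> * ?m)"
    using m by (simp add: ennreal_divide_times ennreal_mult)
  let ?B = "{x \<in> R. \<mu> * \<alpha> < \<bar>f x - c\<bar>}"
  \<comment> \<open>This factor moves the height \<open>(\<mu> * \<alpha>) powr \<delta>\<close> to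
    level 1, where Markov's inequality is applied.\<close>
  let ?k = "(\<mu> * \<alpha>) powr (- \<delta>)"
  have sub: "?B \<subseteq> {x \<in> R. 1 \<le> ennreal ?k * ennreal (\<bar>f x - c\<bar> powr \<delta>)}"
  proof safe
    fix x assume "\<mu> * \<alpha> < \<bar>f x - c\<bar>"
    then have "(\<mu> * \<alpha>) powr \<delta> \<le> \<bar>f x - c\<bar> powr \<delta>"
      using \<mu> \<alpha> \<delta> by (intro powr_mono2) auto
    then have "1 \<le> ?k * \<bar>f x - c\<bar> powr \<delta>"
      using \<mu> \<alpha> by (simp add: powr_minus field_simps)
    then show "1 \<le> ennreal ?k * ennreal (\<bar>f x - c\<bar> powr \<delta>)"
      by (simp add: ennreal_mult[symmetric])
  qed
  have meas: "{x \<in> R. 1 \<le> ennreal ?k * ennreal (\<bar>f x - c\<bar> powr \<delta>)} \<in> sets lebesgue"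
  proof -
    have "R \<inter> {x \<in> space lebesgue. 1 \<le> ennreal ?k * ennreal (\<bar>f x - c\<bar> powr \<delta>)} \<in> sets lebesgue"
      by (intro sets.Int) measurable
    then show ?thesis by (simp add: Collect_conj_eq)
  qed
  have "emeasure lebesgue ?B \<le> emeasure lebesgue {x \<in> R. 1 \<le> ennreal ?k * ennreal (\<bar>f x - c\<bar> powr \<delta>)}"
    using sub meas by (rule emeasure_mono)
  also have "\<dots> \<le> ennreal ?k * (\<integral>\<^sup>+x\<in>R. ennreal (\<bar>f x - c\<bar> powr \<delta>) \<partial>lebesgue)"
    by (intro nn_integral_Markov_inequality) measurable
  also have "\<dots> \<le> ennreal ?k * ennreal ((2 * \<alpha>) powr \<delta> * ?m)"
    using int by (rule mult_left_mono) simp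
  also have "\<dots> = ennreal ((2 / \<mu>) powr \<delta> * ?m)"
    using \<mu> \<alpha> by (simp add: ennreal_mult[symmetric] powr_mult powr_divide powr_minus field_simps)
  finally have "emeasure lebesgue ?B \<le> ennreal ((2 / \<mu>) powr \<delta> * ?m)" .
  then have "measure lebesgue ?B \<le> (2 / \<mu>) powr \<delta> * ?m"
    unfolding Sigma_Algebra.measure_def[of lebesgue ?B] by (intro enn2real_leI) simp_all
  then show ?thesis by blast
qed

theorem oscillation_self_improvement:
  fixes f :: "real ^ 'n \<Rightarrow> real"
  assumes f: "f \<in> borel_measurable lebesgue" and \<delta>: "0 < \<delta>"
    and a_pos: "\<And>R. R \<in> rectangles \<Longrightarrow> 0 < a R"
    and osc: "\<And>R. R \<in> rectangles \<Longrightarrow> (INF c :: real. ennreal_powr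
             ((\<integral>\<^sup>+x\<in>R. ennreal (\<bar>f x - c\<bar> powr \<delta>) \<partial>lebesgue) / emeasure lebesgue R) (1 / \<delta>)) \<le> ennreal (a R)"
    and \<epsilon>: "0 < \<epsilon>" "\<epsilon> < 1"
    and small: "\<And>R F. R \<in> rectangles \<Longrightarrow> F \<subseteq> dyadic_subrectangles R \<Longrightarrow> disjoint F \<Longrightarrow>
      measure lebesgue (\<Union>F) \<le> \<epsilon> * measure lebesgue R \<Longrightarrow>
      (\<integral>\<^sup>+S. ennreal (a S * measure lebesgue S) \<partial>count_space F) \<le> ennreal (a R * measure lebesgue R / 2)"
    and R: "R \<in> rectangles"
  shows "(INF c :: real. (\<integral>\<^sup>+x\<in>R. ennreal \<bar>f x - c\<bar> \<partial>lebesgue) / emeasure lebesgue R)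
     \<le> ennreal (10 * (\<epsilon> / (2 * 2 ^ CARD('n))) powr (- 1 / \<delta>) * a R)"
proof -
  define \<kappa> where "\<kappa> = \<epsilon> / (2 * 2 ^ CARD('n))"
  have \<kappa>: "\<kappa> > 0" using \<epsilon> by (simp add: \<kappa>_def)
  \<comment> \<open>This solves \<open>(2 / \<mu>) powr \<delta> = \<kappa>\<close>, with
    \<open>\<kappa>\<close> the proportion allowed by the locale; the final constant is
    \<open>5 * \<mu>\<close>.\<close>
  define \<mu> where "\<mu> = 2 * \<kappa> powr (- 1 / \<delta>)"
  have \<mu>: "\<mu> > 0" using \<kappa> by (simp add: \<mu>_def)
  have \<mu>\<kappa>: "(2 / \<mu>) powr \<delta> = \<kappa>"
  proof -
    have "2 / \<mu> = \<kappa> powr (1 / \<delta>)" by (simp add: \<mu>_def powr_minus_divide)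
    then show ?thesis using \<delta> \<kappa> by (simp add: powr_powr)
  qed
  have "\<forall>Q\<in>rectangles. \<exists>c. measure lebesgue {x \<in> Q. \<mu> * a Q < \<bar>f x - c\<bar>} \<le> \<kappa> * measure lebesgue Q"
    using near_optimal_center[OF f \<delta> _ a_pos \<mu> osc] by (simp add: \<mu>\<kappa>)
  then obtain c where c: "\<forall>Q\<in>rectangles.
      measure lebesgue {x \<in> Q. \<mu> * a Q < \<bar>f x - c Q\<bar>} \<le> \<kappa> * measure lebesgue Q"
    by (rule bchoice[THEN exE])
  interpret small_oscillation f a c \<mu> \<epsilon>
    by unfold_locales (use f a_pos \<mu> \<epsilon> c[rule_format] small in \<open>simp_all add: \<kappa>_def\<close>)
  have m: "0 < measure lebesgue R" by (rule rectangle_measure_pos[OF R])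
  have "(INF c :: real. (\<integral>\<^sup>+x\<in>R. ennreal \<bar>f x - c\<bar> \<partial>lebesgue) / emeasure lebesgue R)
      \<le> (\<integral>\<^sup>+x\<in>R. ennreal \<bar>f x - c R\<bar> \<partial>lebesgue) / emeasure lebesgue R"
    by (rule INF_lower) simp
  also have "\<dots> \<le> ennreal (5 * \<mu> * a R * measure lebesgue R) / ennreal (measure lebesgue R)"
    unfolding emeasure_rectangle[OF R] using mean_oscillation[OF R] by (rule divide_right_mono_ennreal)
  also have "\<dots> = ennreal (5 * \<mu> * a R)"
    using m \<mu> a_pos[OF R] by (simp add: divide_ennreal)
  finally show ?thesis by (simp add: \<mu>_def \<kappa>_def)
qed

theorem theorem2p14:
  shows "(\<exists>C :: real \<Rightarrow> real \<Rightarrow> real \<Rightarrow> real.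
     \<forall>(f :: real ^ 'n \<Rightarrow> real) (a :: (real ^ 'n) set \<Rightarrow> real) (\<delta> :: real) (p :: real).
       f \<in> borel_measurable lebesgue \<longrightarrow> 0 < \<delta> \<longrightarrow> \<delta> < 1 \<longrightarrow>
       (\<forall>R \<in> rectangles. 0 < a R) \<longrightarrow>
       (\<forall>R \<in> rectangles.
          (INF c :: real. ennreal_powr
             ((\<integral>\<^sup>+x\<in>R. ennreal (\<bar>f x - c\<bar> powr \<delta>) \<partial>lebesgue) / emeasure lebesgue R) (1 / \<delta>))
          \<le> ennreal (a R)) \<longrightarrow>
       1 < p \<longrightarrow> Dp_condition p a \<longrightarrow>
       (\<forall>R \<in> rectangles.
          (INF c :: real. (\<integral>\<^sup>+x\<in>R. ennreal \<bar>f x - c\<bar> \<partial>lebesgue) / emeasure lebesgue R)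
          \<le> ennreal (C p \<delta> (Dp_norm p a) * a R)))
   \<and>
   (\<exists>C :: real \<Rightarrow> real \<Rightarrow> real \<Rightarrow> real.
     \<forall>(f :: real ^ 'n \<Rightarrow> real) (a :: (real ^ 'n) set \<Rightarrow> real) (\<delta> :: real) (s :: real).
       f \<in> borel_measurable lebesgue \<longrightarrow> 0 < \<delta> \<longrightarrow> \<delta> < 1 \<longrightarrow>
       (\<forall>R \<in> rectangles. 0 < a R) \<longrightarrow>
       (\<forall>R \<in> rectangles.
          (INF c :: real. ennreal_powr
             ((\<integral>\<^sup>+x\<in>R. ennreal (\<bar>f x - c\<bar> powr \<delta>) \<partial>lebesgue) / emeasure lebesgue R) (1 / \<delta>))
          \<le> ennreal (a R)) \<longrightarrow>
       0 < s \<longrightarrow> SD1_condition s a \<longrightarrow>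
       (\<forall>R \<in> rectangles.
          (INF c :: real. (\<integral>\<^sup>+x\<in>R. ennreal \<bar>f x - c\<bar> \<partial>lebesgue) / emeasure lebesgue R)
          \<le> ennreal (C \<delta> s (SD1_norm s a) * a R)))"
proof -
  \<comment> \<open>These are the values of \<epsilon> in \<open>Dp_small\<close> and
    \<open>SD1_small\<close> for \<open>K = max 1 (N + 1)\<close>, where \<open>N\<close> stands for
    the norm. Adding 1 moves strictly above the infimum, so some admissible constant lies below
    \<open>K\<close>; the maximum ensures \<open>1 \<le> K\<close>.\<close>
  define eD where "eD p N = 1 / (4 * (4 * max 1 (N + 1) powr p) powr (1 / (p - 1)))" for p N :: real
  define eS where "eS s N = (1 / (2 * max 1 (N + 1))) powr s" for s N :: real
  show ?thesis
  proof (rule conjI, goal_cases)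
    case 1
    show ?case
    proof (rule exI[of _ "\<lambda>p \<delta> N. 10 * (eD p N / (2 * 2 ^ CARD('n))) powr (- 1 / \<delta>)"],
        intro allI impI ballI)
      fix f :: "real ^ 'n \<Rightarrow> real" and a :: "(real ^ 'n) set \<Rightarrow> real" and \<delta> p :: real and R :: "(real ^ 'n) set"
      assume f: "f \<in> borel_measurable lebesgue" and \<delta>: "0 < \<delta>" "\<delta> < 1" and pos: "\<forall>R\<in>rectangles. 0 < a R"
        and osc: "\<forall>R \<in> rectangles.
            (INF c :: real. ennreal_powr
               ((\<integral>\<^sup>+x\<in>R. ennreal (\<bar>f x - c\<bar> powr \<delta>) \<partial>lebesgue) / emeasure lebesgue R) (1 / \<delta>))
            \<le> ennreal (a R)"
        and p: "1 < p" and Dp: "Dp_condition p a" and R: "R \<in> rectangles"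
      let ?K = "max 1 (Dp_norm p a + 1)"
      obtain K0 where K0: "Dp_bound p a K0" "K0 \<le> ?K"
        using Dp cInf_lessD[of "{c. Dp_bound p a c}" "Dp_norm p a + 1"]
        by (force simp: Dp_condition_def Dp_norm_def)
      have "1 \<le> ?K powr p" using p by (intro ge_one_powr_ge_zero) auto
      \<comment> \<open>The height factor \<open>\<tau>\<close> of \<open>Dp_small\<close> is thus
        at least 1, so \<open>eD\<close> is at most a quarter.\<close>
      then have "1 \<le> (4 * ?K powr p) powr (1 / (p - 1))"
        using p by (intro ge_one_powr_ge_zero) auto
      then have e: "0 < eD p (Dp_norm p a)" "eD p (Dp_norm p a) < 1"
        by (simp_all add: eD_def)
      show "(INF c :: real. (\<integral>\<^sup>+x\<in>R. ennreal \<bar>f x - c\<bar> \<partial>lebesgue) / emeasure lebesgue R)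
            \<le> ennreal (10 * (eD p (Dp_norm p a) / (2 * 2 ^ CARD('n))) powr (- 1 / \<delta>) * a R)"
      proof (rule oscillation_self_improvement[OF f \<delta>(1) _ _ e _ R])
        show "(\<integral>\<^sup>+S. ennreal (a S * measure lebesgue S) \<partial>count_space F) \<le> ennreal (a R * measure lebesgue R / 2)"
          if "R \<in> rectangles" "F \<subseteq> dyadic_subrectangles R" "disjoint F"
            "measure lebesgue (\<Union>F) \<le> eD p (Dp_norm p a) * measure lebesgue R" for R F
          using that pos by (intro Dp_small[OF _ p K0]) (auto simp: eD_def)
      qed (use pos osc in auto)
    qed
  next
    case 2
    show ?case
    proof (rule exI[of _ "\<lambda>\<delta> s N. 10 * (eS s N / (2 * 2 ^ CARD('n))) powr (- 1 / \<delta>)"],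
        intro allI impI ballI)
      fix f :: "real ^ 'n \<Rightarrow> real" and a :: "(real ^ 'n) set \<Rightarrow> real" and \<delta> s :: real and R :: "(real ^ 'n) set"
      assume f: "f \<in> borel_measurable lebesgue" and \<delta>: "0 < \<delta>" "\<delta> < 1" and pos: "\<forall>R\<in>rectangles. 0 < a R"
        and osc: "\<forall>R \<in> rectangles.
            (INF c :: real. ennreal_powr
               ((\<integral>\<^sup>+x\<in>R. ennreal (\<bar>f x - c\<bar> powr \<delta>) \<partial>lebesgue) / emeasure lebesgue R) (1 / \<delta>))
            \<le> ennreal (a R)"
        and s: "0 < s" and SD: "SD1_condition s a" and R: "R \<in> rectangles"
      let ?K = "max 1 (SD1_norm s a + 1)"
      obtain K0 where K0: "SD1_bound s a K0" "K0 \<le> ?K"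
        using SD cInf_lessD[of "{c. SD1_bound s a c}" "SD1_norm s a + 1"]
        by (force simp: SD1_condition_def SD1_norm_def)
      have "1 / (2 * K) < 1" if "1 \<le> K" for K :: real
        using that by (simp add: divide_less_eq)
      from this[of ?K] have "(1 / (2 * ?K)) powr s < 1 powr s"
        using s by (intro powr_less_mono2) auto
      then have e: "0 < eS s (SD1_norm s a)" "eS s (SD1_norm s a) < 1"
        by (simp_all add: eS_def)
      show "(INF c :: real. (\<integral>\<^sup>+x\<in>R. ennreal \<bar>f x - c\<bar> \<partial>lebesgue) / emeasure lebesgue R)
            \<le> ennreal (10 * (eS s (SD1_norm s a) / (2 * 2 ^ CARD('n))) powr (- 1 / \<delta>) * a R)"
      proof (rule oscillation_self_improvement[OF f \<delta>(1) _ _ e _ R])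
        show "(\<integral>\<^sup>+S. ennreal (a S * measure lebesgue S) \<partial>count_space F) \<le> ennreal (a R * measure lebesgue R / 2)"
          if "R \<in> rectangles" "F \<subseteq> dyadic_subrectangles R" "disjoint F"
            "measure lebesgue (\<Union>F) \<le> eS s (SD1_norm s a) * measure lebesgue R" for R F
          using that pos by (intro SD1_small[OF _ s K0]) (auto simp: eS_def)
      qed (use pos osc in auto)
    qed
  qed
qed

end
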